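(* Let $\Omega$ be any open subset of $\mathbb{R}^{N+1}$, let $f$ be continuous on $\Omega$ and let $u\le0$ (respectively $u\ge0$) be a classical solution to $\mathscr{L}u=f$ in $\Omega$ with $f\ge0$ (respectively $f\le0$) in $\Omega$. If $u(z_0)=0$ for some $z_0\in\Omega$, then $$u(z)=0\quad\text{and}\quad f(z)=0\qquad\text{for every } z\in\overline{\mathscr{A}_{z_0}(\Omega)},$$ where the closure is taken in $\Omega$.
   Context: Operator. Points of $\mathbb{R}^{N+1}$ are $z=(x,t)$, $x\in\mathbb{R}^N$, $t\in\mathbb{R}$; $\mathrm{div}$, $\nabla_x$, $\langle\cdot,\cdot\rangle$ are the divergence, gradient and inner product in $\mathbb{R}^N$. The operator is $$\mathscr{L}u(z)=\mathrm{div}\big(A(z)\nabla_xu(z)\big)+\langle b(z),\nabla_xu(z)\rangle+c(z)u(z)-\frac{\partial u}{\partial t}(z),$$ with $A=(a_{ij})_{i,j=1,\dots,N}$ symmetric and $b=(b_1,\dots,b_N)$. Standing assumptions: there are $M>0$, $\alpha\in\,]0,1]$ such that each function $g$ among $c,\ a_{ij},\ \partial a_{ij}/\partial x_i,\ b_i,\ \partial b_i/\partial x_i$ $(i,j=1,\dots,N)$ satisfies $|g(x,t)-g(y,s)|\le M(|x-y|^\alpha+|t-s|^{\alpha/2})$ for all $(x,t),(y,s)\in\mathbb{R}^{N+1}$; the coefficients are bounded; and there are $0<\lambda<\Lambda$ with $\lambda|\xi|^2\le\langle A(z)\xi,\xi\rangle\le\Lambda|\xi|^2$, $|\partial a_{ij}/\partial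 x_i(z)|\le\Lambda$, $|b_i(z)|\le\Lambda$, $|c(z)|\le\Lambda$ for all $\xi\in\mathbb{R}^N$, $z\in\mathbb{R}^{N+1}$, $i,j$. Classical solution: for $f$ continuous on $\Omega$, $u$ is a classical solution of $\mathscr{L}u=f$ in $\Omega$ if $u,\ \partial_{x_j}u,\ \partial^2_{x_ix_j}u,\ \partial_tu$ are continuous in $\Omega$ and the equation holds at every point of $\Omega$. Attainable set. A curve $\gamma:[0,T]\to\mathbb{R}^{N+1}$ is $\mathscr{L}$-admissible if it is absolutely continuous and $\dot\gamma(s)=(\dot x_1(s),\dots,\dot x_N(s),-1)$ for almost every $s\in[0,T]$, with $\dot x_1,\dots,\dot x_N\in L^2([0,T])$. For $\Omega$ open and $z_0\in\Omega$, $\mathscr{A}_{z_0}(\Omega)$ is the set of all $z\in\Omega$ for which there exists an $\mathscr{L}$-admissible curve $\gamma:[0,T]\to\Omega$ with $\gamma(0)=z_0$ and $\gamma(T)=z$. *)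

theory Defs
  imports "HOL-Analysis.Analysis"
begin

text \<open>A point \<open>z = (x, t)\<close> of \<open>\<real>\<^sup>N \<times> \<real>\<close> is a pair of type \<open>(real ^ 'n) \<times> real\<close>.
  The operator \<^const>\<open>deriv\<close> is total; existence of the derivative is asserted separately by
  the predicates \<open>x_differentiable\<close> and \<open>t_differentiable\<close>.\<close>

definition x_differentiable :: "'n \<Rightarrow> ((real ^ 'n) \<times> real \<Rightarrow> real) \<Rightarrow> (real ^ 'n) \<times> real \<Rightarrow> bool" where
  "x_differentiable i g z \<longleftrightarrow> (\<lambda>h. g (fst z + h *\<^sub>R axis i 1, snd z)) field_differentiable (at 0)"

definition t_differentiable :: "((real ^ 'n) \<times> real \<Rightarrow> real) \<Rightarrow> (real ^ 'n) \<times> real \<Rightarrow> bool" where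
  "t_differentiable g z \<longleftrightarrow> (\<lambda>t. g (fst z, t)) field_differentiable (at (snd z))"

definition dx :: "'n \<Rightarrow> ((real ^ 'n) \<times> real \<Rightarrow> real) \<Rightarrow> (real ^ 'n) \<times> real \<Rightarrow> real" where
  "dx i g z = deriv (\<lambda>h. g (fst z + h *\<^sub>R axis i 1, snd z)) 0"

definition dt :: "((real ^ 'n) \<times> real \<Rightarrow> real) \<Rightarrow> (real ^ 'n) \<times> real \<Rightarrow> real" where
  "dt g z = deriv (\<lambda>t. g (fst z, t)) (snd z)"

definition grad_x :: "((real ^ 'n) \<times> real \<Rightarrow> real) \<Rightarrow> (real ^ 'n) \<times> real \<Rightarrow> real ^ 'n" where
  "grad_x g z = (\<chi> i. dx i g z)"

definition div_x :: "((real ^ 'n) \<times> real \<Rightarrow> real ^ 'n) \<Rightarrow> (real ^ 'n) \<times> real \<Rightarrow> real" where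
  "div_x F z = (\<Sum>i\<in>UNIV. dx i (\<lambda>w. F w $ i) z)"

definition parabolic_op ::
  "((real ^ 'n) \<times> real \<Rightarrow> real ^ 'n ^ 'n) \<Rightarrow> ((real ^ 'n) \<times> real \<Rightarrow> real ^ 'n) \<Rightarrow>
   ((real ^ 'n) \<times> real \<Rightarrow> real) \<Rightarrow> ((real ^ 'n) \<times> real \<Rightarrow> real) \<Rightarrow> (real ^ 'n) \<times> real \<Rightarrow> real" where
  "parabolic_op A b c u z =
     div_x (\<lambda>w. A w *v grad_x u w) z + b z \<bullet> grad_x u z + c z * u z - dt u z"

definition parabolic_hoelder :: "real \<Rightarrow> real \<Rightarrow> ((real ^ 'n) \<times> real \<Rightarrow> real) \<Rightarrow> bool" where
  "parabolic_hoelder M \<alpha> g \<longleftrightarrow>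
     (\<forall>x t y s. \<bar>g (x, t) - g (y, s)\<bar> \<le> M * (norm (x - y) powr \<alpha> + \<bar>t - s\<bar> powr (\<alpha> / 2)))"

definition classical_solution ::
  "((real ^ 'n) \<times> real \<Rightarrow> real ^ 'n ^ 'n) \<Rightarrow> ((real ^ 'n) \<times> real \<Rightarrow> real ^ 'n) \<Rightarrow>
   ((real ^ 'n) \<times> real \<Rightarrow> real) \<Rightarrow> ((real ^ 'n) \<times> real \<Rightarrow> real) \<Rightarrow> ((real ^ 'n) \<times> real) set \<Rightarrow>
   ((real ^ 'n) \<times> real \<Rightarrow> real) \<Rightarrow> bool" where
  "classical_solution A b c f \<Omega> u \<longleftrightarrow>
     continuous_on \<Omega> u \<and>
     (\<forall>j. (\<forall>z\<in>\<Omega>. x_differentiable j u z) \<and> continuous_on \<Omega> (dx j u)) \<and>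
     (\<forall>i j. (\<forall>z\<in>\<Omega>. x_differentiable i (dx j u) z) \<and> continuous_on \<Omega> (dx i (dx j u))) \<and>
     (\<forall>z\<in>\<Omega>. t_differentiable u z) \<and> continuous_on \<Omega> (dt u) \<and>
     (\<forall>z\<in>\<Omega>. parabolic_op A b c u z = f z)"

text \<open>The usual \<open>\<epsilon>\<close>-\<open>\<delta>\<close> definition over finite families of non-overlapping compact
  subintervals; such a family is a division of its own union.\<close>

definition absolutely_continuous_on :: "real \<Rightarrow> real \<Rightarrow> (real \<Rightarrow> 'a::real_normed_vector) \<Rightarrow> bool" where
  "absolutely_continuous_on a b g \<longleftrightarrow>
     (\<forall>\<epsilon>>0. \<exists>\<delta>>0. \<forall>D. D division_of \<Union>D \<and> \<Union>D \<subseteq> {a..b} \<and> (\<Sum>K\<in>D. Sup K - Inf K) < \<delta> \<longrightarrow>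
        (\<Sum>K\<in>D. norm (g (Sup K) - g (Inf K))) < \<epsilon>)"

definition L2_on :: "real set \<Rightarrow> (real \<Rightarrow> real) \<Rightarrow> bool" where
  "L2_on S g \<longleftrightarrow> g \<in> borel_measurable (lebesgue_on S) \<and> integrable (lebesgue_on S) (\<lambda>s. (g s)\<^sup>2)"

definition admissible_curve :: "real \<Rightarrow> (real \<Rightarrow> (real ^ 'n) \<times> real) \<Rightarrow> bool" where
  "admissible_curve T \<gamma> \<longleftrightarrow>
     absolutely_continuous_on 0 T \<gamma> \<and>
     (\<exists>x'. (\<forall>i. L2_on {0..T} (\<lambda>s. x' s $ i)) \<and>
        (AE s in lebesgue_on {0..T}. (\<gamma> has_vector_derivative (x' s, -1)) (at s within {0..T})))"

definition attainable_set ::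
  "((real ^ 'n) \<times> real) set \<Rightarrow> (real ^ 'n) \<times> real \<Rightarrow> ((real ^ 'n) \<times> real) set" where
  "attainable_set \<Omega> z0 =
     {z \<in> \<Omega>. \<exists>T\<ge>0. \<exists>\<gamma>. admissible_curve T \<gamma> \<and> \<gamma> ` {0..T} \<subseteq> \<Omega> \<and> \<gamma> 0 = z0 \<and> \<gamma> T = z}"

end

theory Submission
  imports Defs
begin

text \<open>After expanding the divergence, the equation reads
\<open>\<Sum> A i j \<partial>i \<partial>j u + \<beta> \<bullet> \<nabla>u + c u - \<partial>t u = f\<close> with a bounded drift \<open>\<beta>\<close>, and
by passing to \<open>- u\<close> and \<open>- f\<close> if necessary one may assume \<open>u \<le> 0\<close> and \<open>f \<ge> 0\<close>. Because of this sign
\<open>c\<close> can be replaced by a nonpositive constant, so \<open>u\<close> is a subsolution of an operator that obeys the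
weak maximum principle.

The heart of the matter is that a zero of \<open>u\<close> propagates along every segment in \<open>\<Omega>\<close> on which time
decreases (\<open>zero_propagates_along_segment\<close>). If \<open>u\<close> were negative at the far end of such a segment,
it would be negative on a small disc there, and a comparison on the thin oblique cylinder over this
disc would make \<open>u\<close> negative at the near end as well. The comparison function is
\<open>(r\<^sup>2 - |x - x(t)|\<^sup>2)\<^sup>2 exp (- K t)\<close>, where \<open>x(t)\<close> is the axis of the cylinder: it vanishes on the
lateral boundary and, for large \<open>K\<close>, is a strict subsolution on the whole cylinder
(\<open>barrier_strict_subsolution\<close>). The comparison itself rests on the behaviour of derivatives at a
maximum over the past (\<open>parabolic_maximum\<close>) and on the fact that a positive semidefinite matrix has
nonpositive pairing with a negative semidefinite one (\<open>psd_nsd_pairing_nonpos\<close>).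

An admissible curve is continuous, and its time component decreases at unit speed because an
absolutely continuous function with constant derivative almost everywhere is affine
(\<open>absolutely_continuous_constant_derivative\<close>). Joining sufficiently many points of the curve by
segments gives a polygon in \<open>\<Omega>\<close> directed to the past, along which the zero travels. Hence \<open>u\<close>
vanishes on the attainable set. At each of its points \<open>u\<close> has a maximum, so that \<open>f\<close>, being equal to the
left-hand side of the equation, is nonpositive and therefore zero. Continuity of \<open>u\<close> and \<open>f\<close> extends
both equalities to the closure in \<open>\<Omega>\<close>.\<close>

section \<open>Derivatives along a spatial direction\<close>

text \<open>Only partial derivatives along the coordinate axes are given, and their continuity is what turns
them into derivatives along an arbitrary direction \<open>\<xi>\<close>. The coordinates of \<open>\<xi>\<close> are switched on one
at a time: the displacement splits into the part already treated and a multiple of one axis, and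
the theorem on functions of two variables with one continuous partial derivative applies.\<close>

lemma directional_derivative:
  fixes g :: "(real ^ 'n) \<times> real \<Rightarrow> real"
  assumes S: "open S" "z \<in> S"
    and P: "\<And>i w. w \<in> S \<Longrightarrow>
      ((\<lambda>h. g (fst w + h *\<^sub>R axis i 1, snd w)) has_real_derivative P i w) (at 0)"
    and contP: "\<And>i. continuous_on S (P i)"
  shows "((\<lambda>s. g (fst z + s *\<^sub>R \<xi>, snd z)) has_real_derivative (\<Sum>i\<in>UNIV. P i z * \<xi> $ i)) (at 0)"
proof -
  define part where "part = (\<lambda>I. \<Sum>i\<in>I. \<xi> $ i *\<^sub>R axis i 1 :: real ^ 'n)"
  have "((\<lambda>s. g (fst z + s *\<^sub>R part I, snd z)) has_real_derivative (\<Sum>i\<in>I. P i z * \<xi> $ i)) (at 0)"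
    if "finite I" for I
    using that
  proof induction
    case empty
    then show ?case by (simp add: part_def)
  next
    case (insert k I)
    define m where "m = (\<lambda>a b. (fst z + a *\<^sub>R part I + b *\<^sub>R (\<xi> $ k *\<^sub>R axis k 1), snd z))"
    have m0: "m 0 0 = z" by (simp add: m_def)
    have contm: "continuous_on UNIV (\<lambda>(a, b). m a b)"
      unfolding m_def case_prod_unfold by (intro continuous_intros)
    have "open ((\<lambda>(a, b). m a b) -` S)"
      using contm S(1) by (simp add: continuous_on_open_vimage)
    moreover have "(0, 0) \<in> (\<lambda>(a, b). m a b) -` S"
      using m0 S(2) by simp
    ultimately obtain U V where UV: "open U" "open V" "0 \<in> U" "0 \<in> V"
      "U \<times> V \<subseteq> (\<lambda>(a, b). m a b) -` S"
      by (elim open_prod_elim) auto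
    obtain e where e: "e > 0" "ball 0 e \<subseteq> U" "ball 0 e \<subseteq> V"
    proof -
      obtain e1 e2 where "e1 > 0" "ball 0 e1 \<subseteq> U" "e2 > 0" "ball 0 e2 \<subseteq> V"
        using UV by (meson open_contains_ball)
      then show thesis by (intro that[of "min e1 e2"]) auto
    qed
    define B where "B = ball (0::real) e"
    have mS: "m a b \<in> S" if "a \<in> B" "b \<in> B" for a b
    proof -
      have "(a, b) \<in> U \<times> V"
        using that e(2,3) unfolding B_def by (intro SigmaI) (erule (1) subsetD[rotated])+
      then show ?thesis using subsetD[OF UV(5)] by fastforce
    qed
    have "((\<lambda>(a, b). g (m a b)) has_derivative
        (\<lambda>(ta, tb). (\<Sum>i\<in>I. P i z * \<xi> $ i) * ta + blinfun_mult_right (P k (m 0 0) * \<xi> $ k) tb)) (at (0, 0) within B \<times> B)"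
    proof (rule has_derivative_partialsI[where fy = "\<lambda>a b. blinfun_mult_right (P k (m a b) * \<xi> $ k)"])
      show "((\<lambda>a. g (m a 0)) has_derivative (*) (\<Sum>i\<in>I. P i z * \<xi> $ i)) (at 0 within B)"
        using insert.IH unfolding has_field_derivative_def m_def
        by (simp add: has_derivative_at_withinI)
    next
      fix a b assume ab: "a \<in> B" "b \<in> B"
      let ?w = "m a b"
      have 1: "((\<lambda>h. g (fst ?w + h *\<^sub>R axis k 1, snd ?w)) has_real_derivative P k ?w) (at (0 * \<xi> $ k))"
        using P[OF mS[OF ab]] by simp
      have 2: "((\<lambda>s. s * \<xi> $ k) has_real_derivative \<xi> $ k) (at 0)"
        by (auto intro!: derivative_eq_intros)
      have 3: "((\<lambda>s. g (fst ?w + (s * \<xi> $ k) *\<^sub>R axis k 1, snd ?w)) has_real_derivative P k ?w * \<xi> $ k) (at 0)"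
        using DERIV_chain2[OF 1 2] .
      have "(\<lambda>s. g (fst ?w + (s * \<xi> $ k) *\<^sub>R axis k 1, snd ?w)) = (\<lambda>s. g (m a (s + b)))"
        by (simp add: m_def algebra_simps)
      then have "((\<lambda>s. g (m a s)) has_real_derivative P k ?w * \<xi> $ k) (at b)"
        using 3 by (simp add: DERIV_at_within_shift DERIV_shift[of _ _ 0 b, simplified])
      then show "((\<lambda>b. g (m a b)) has_derivative blinfun_mult_right (P k (m a b) * \<xi> $ k)) (at b within B)"
        unfolding has_field_derivative_def by (simp add: has_derivative_at_withinI)
    next
      have "continuous (at (0,0) within B \<times> B) (\<lambda>ab. P k (m (fst ab) (snd ab)))"
      proof -
        have "continuous_on (B \<times> B) (\<lambda>ab. P k (m (fst ab) (snd ab)))"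
        proof (rule continuous_on_compose2[OF contP[of k]])
          show "continuous_on (B \<times> B) (\<lambda>ab. m (fst ab) (snd ab))"
            using contm by (auto simp: case_prod_unfold intro: continuous_on_subset)
        qed (use mS in auto)
        then show ?thesis using e(1)
          by (auto simp: continuous_on_eq_continuous_within B_def)
      qed
      then show "continuous (at (0, 0) within B \<times> B) (\<lambda>(a, b). blinfun_mult_right (P k (m a b) * \<xi> $ k))"
        unfolding case_prod_unfold
        by (intro bounded_linear.continuous[OF bounded_linear_blinfun_mult_right] continuous_intros)
    qed (use e in \<open>auto simp: B_def\<close>)
    then have D: "((\<lambda>(a, b). g (m a b)) has_derivative
        (\<lambda>(ta, tb). (\<Sum>i\<in>I. P i z * \<xi> $ i) * ta + P k z * \<xi> $ k * tb)) (at (0, 0))"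
      using e(1) by (simp add: B_def m0 at_within_open[of "(0,0)" "ball 0 e \<times> ball 0 e"] open_Times)
    have "((\<lambda>s::real. (s, s)) has_derivative (\<lambda>s. (s, s))) (at 0)"
      by (auto intro!: derivative_eq_intros)
    from diff_chain_at[OF this] D
    have "((\<lambda>s. g (m s s)) has_derivative
        (\<lambda>s. (\<Sum>i\<in>I. P i z * \<xi> $ i) * s + P k z * \<xi> $ k * s)) (at 0)"
      by (fastforce simp: o_def)
    moreover have "(\<lambda>s. g (m s s)) = (\<lambda>s. g (fst z + s *\<^sub>R part (insert k I), snd z))"
      using insert.hyps by (simp add: m_def part_def algebra_simps)
    moreover have "(\<lambda>s. (\<Sum>i\<in>I. P i z * \<xi> $ i) * s + P k z * \<xi> $ k * s)
        = (*) (\<Sum>i\<in>insert k I. P i z * \<xi> $ i)"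
      using insert.hyps by (auto simp: algebra_simps)
    ultimately show ?case
      unfolding has_field_derivative_def by simp
  qed
  from this[of UNIV] show ?thesis
    using basis_expansion[of \<xi>] by (simp add: part_def scalar_mult_eq_scaleR)
qed

section \<open>Pairing a positive with a negative quadratic form\<close>

lemma sum_insert_square:
  fixes F :: "'a \<Rightarrow> 'a \<Rightarrow> real"
  assumes "finite S" "k \<notin> S"
  shows "(\<Sum>i\<in>insert k S. \<Sum>j\<in>insert k S. F i j) =
    F k k + (\<Sum>j\<in>S. F k j) + (\<Sum>i\<in>S. F i k) + (\<Sum>i\<in>S. \<Sum>j\<in>S. F i j)"
  using assms by (simp add: sum.distrib)

text \<open>A symmetric positive semidefinite matrix is a sum of rank-one matrices \<open>w w\<^sup>T\<close>, and pairing \<open>w w\<^sup>T\<close>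
with \<open>H\<close> gives the value of the form \<open>H\<close> at \<open>w\<close>. The induction splits off one such matrix at a
time, by passing to the Schur complement of a diagonal entry.\<close>

lemma psd_nsd_pairing_nonpos:
  fixes A H :: "'a \<Rightarrow> 'a \<Rightarrow> real"
  assumes "finite S"
    and "\<And>i j. A i j = A j i"
    and "\<And>x. 0 \<le> (\<Sum>i\<in>S. \<Sum>j\<in>S. A i j * (x i * x j))"
    and "\<And>x. (\<Sum>i\<in>S. \<Sum>j\<in>S. H i j * (x i * x j)) \<le> 0"
  shows "(\<Sum>i\<in>S. \<Sum>j\<in>S. A i j * H i j) \<le> 0"
  using assms
proof (induction arbitrary: A)
  case empty
  then show ?case by simp
next
  case (insert k S)
  note split = sum_insert_square[OF insert.hyps]
  note sym = insert.prems(1)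
  have restrict: "(\<Sum>i\<in>insert k S. \<Sum>j\<in>insert k S. F i j * ((x(k := 0)) i * (x(k := 0)) j)) =
    (\<Sum>i\<in>S. \<Sum>j\<in>S. F i j * (x i * x j))" for F and x :: "'a \<Rightarrow> real"
  proof -
    have "(\<Sum>i\<in>S. \<Sum>j\<in>S. F i j * ((x(k := 0)) i * (x(k := 0)) j)) =
      (\<Sum>i\<in>S. \<Sum>j\<in>S. F i j * (x i * x j))"
      using insert.hyps by (intro sum.cong refl) auto
    then show ?thesis unfolding split by simp
  qed
  have nsdS: "(\<Sum>i\<in>S. \<Sum>j\<in>S. H i j * (x i * x j)) \<le> 0" for x
    using insert.prems(3)[of "x(k := 0)"] by (simp only: restrict)
  have psdS: "0 \<le> (\<Sum>i\<in>S. \<Sum>j\<in>S. A i j * (x i * x j))" for x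
    using insert.prems(2)[of "x(k := 0)"] by (simp only: restrict)
  have form: "(\<Sum>i\<in>insert k S. \<Sum>j\<in>insert k S. A i j * ((x(k := s)) i * (x(k := s)) j)) =
     A k k * s\<^sup>2 + 2 * s * (\<Sum>j\<in>S. A k j * x j) + (\<Sum>i\<in>S. \<Sum>j\<in>S. A i j * (x i * x j))"
    for x s
  proof -
    define y where "y = x(k := s)"
    have y: "y k = s" "\<And>j. j \<in> S \<Longrightarrow> y j = x j"
      using insert.hyps by (auto simp: y_def)
    have 1: "(\<Sum>i\<in>S. \<Sum>j\<in>S. A i j * (y i * y j)) = (\<Sum>i\<in>S. \<Sum>j\<in>S. A i j * (x i * x j))"
      using y(2) by (intro sum.cong refl) simp
    have 2: "(\<Sum>j\<in>S. A k j * (s * y j)) = s * (\<Sum>j\<in>S. A k j * x j)"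
      unfolding sum_distrib_left using y(2) by (intro sum.cong refl) simp
    have 3: "(\<Sum>j\<in>S. A j k * (y j * s)) = s * (\<Sum>j\<in>S. A k j * x j)"
      unfolding sum_distrib_left sym[of _ k] using y(2) by (intro sum.cong refl) simp
    show ?thesis
      unfolding y_def[symmetric] split y(1) 1 2 3 by (simp add: power2_eq_square)
  qed
  have nonneg: "0 \<le> A k k * s\<^sup>2 + 2 * s * (\<Sum>j\<in>S. A k j * x j) +
      (\<Sum>i\<in>S. \<Sum>j\<in>S. A i j * (x i * x j))" for s x
    using insert.prems(2)[of "x(k := s)"] by (simp only: form)
  have Akk: "A k k \<ge> 0"
    using nonneg[of 1 "\<lambda>_. 0"] by simp
  show ?case
  proof (cases "A k k = 0")
    case True
    \<comment> \<open>A nonzero entry next to a zero on the diagonal would make the form unbounded below along a line.\<close>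
    have zero: "A k j = 0" if "j \<in> S" for j
    proof (rule ccontr)
      assume nz: "A k j \<noteq> 0"
      define x where "x = (\<lambda>i. if i = j then 1 else 0 :: real)"
      have "(\<Sum>i\<in>S. A k i * x i) = A k j"
        using that insert.hyps by (simp add: x_def if_distrib[of "(*) _"] cong: if_cong)
      moreover define c where "c = (\<Sum>i\<in>S. \<Sum>j\<in>S. A i j * (x i * x j))"
      ultimately have "0 \<le> 2 * s * A k j + c" for s
        using nonneg[of s x] True by simp
      from this[of "- (c + 1) / A k j"] have "0 \<le> 2 * (- (c + 1) / A k j * A k j) + c"
        by (simp only: mult.assoc)
      then have "c + 2 \<le> 0"
        using nz by simp
      then show False using psdS[of x] unfolding c_def by linarith
    qed
    have "(\<Sum>i\<in>S. \<Sum>j\<in>S. A i j * H i j) \<le> 0"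
      by (rule insert.IH[OF sym psdS nsdS])
    moreover have "A j k = 0" if "j \<in> S" for j
      using zero[OF that] sym[of j k] by simp
    ultimately show ?thesis
      unfolding split using zero True by simp
  next
    case False
    then have pos: "A k k > 0" using Akk by simp
    define A' where "A' = (\<lambda>i j. A i j - A k i * A k j / A k k)"
    have decomp: "(\<Sum>i\<in>S. \<Sum>j\<in>S. A' i j * G i j) =
       (\<Sum>i\<in>S. \<Sum>j\<in>S. A i j * G i j) - (\<Sum>i\<in>S. \<Sum>j\<in>S. G i j * (A k i * A k j)) / A k k" for G
      unfolding A'_def sum_divide_distrib sum_subtractf[symmetric]
      by (intro sum.cong refl) (simp add: algebra_simps)
    have "(\<Sum>i\<in>S. \<Sum>j\<in>S. A' i j * H i j) \<le> 0"
    proof (rule insert.IH)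
      show "A' i j = A' j i" for i j
        using sym[of i j] by (simp add: A'_def mult.commute)
      fix x
      \<comment> \<open>This \<open>s\<close> minimises the form in its \<open>k\<close>-th coordinate; the minimum is the form of the Schur complement.\<close>
      define s where "s = - (\<Sum>j\<in>S. A k j * x j) / A k k"
      have sq: "(\<Sum>i\<in>S. \<Sum>j\<in>S. x i * x j * (A k i * A k j)) = (\<Sum>j\<in>S. A k j * x j)\<^sup>2"
        unfolding power2_eq_square sum_product by (intro sum.cong refl) (simp add: algebra_simps)
      have "(\<Sum>i\<in>S. \<Sum>j\<in>S. A' i j * (x i * x j)) =
         A k k * s\<^sup>2 + 2 * s * (\<Sum>j\<in>S. A k j * x j) + (\<Sum>i\<in>S. \<Sum>j\<in>S. A i j * (x i * x j))"
        unfolding decomp sq s_def using pos by (simp add: field_simps power2_eq_square)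
      then show "0 \<le> (\<Sum>i\<in>S. \<Sum>j\<in>S. A' i j * (x i * x j))"
        using nonneg[of s x] by simp
    qed (rule nsdS)
    moreover have "(\<Sum>i\<in>insert k S. \<Sum>j\<in>insert k S. A i j * H i j) =
       (\<Sum>i\<in>S. \<Sum>j\<in>S. A' i j * H i j) +
       (\<Sum>i\<in>insert k S. \<Sum>j\<in>insert k S. H i j * (A k i * A k j)) / A k k"
    proof -
      have "(\<Sum>j\<in>S. H k j * (A k k * A k j)) / A k k = (\<Sum>j\<in>S. A k j * H k j)"
        unfolding sum_divide_distrib using pos by (intro sum.cong refl) (simp add: field_simps)
      moreover have "(\<Sum>j\<in>S. H j k * (A k j * A k k)) / A k k = (\<Sum>j\<in>S. A j k * H j k)"
        unfolding sum_divide_distrib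
      proof (intro sum.cong refl)
        show "H j k * (A k j * A k k) / A k k = A j k * H j k" for j
          using sym[of j k] pos by simp
      qed
      ultimately show ?thesis
        unfolding split decomp using pos by (simp add: add_divide_distrib)
    qed
    moreover have "(\<Sum>i\<in>insert k S. \<Sum>j\<in>insert k S. H i j * (A k i * A k j)) / A k k \<le> 0"
      using insert.prems(3)[of "A k"] pos by (simp only: divide_nonpos_pos)
    ultimately show ?thesis by linarith
  qed
qed

section \<open>Functions of class C2 in space and C1 in time\<close>

text \<open>The derivatives are explicit parameters: \<open>p j\<close> and \<open>q i j\<close> are the first and second spatial
derivatives of \<open>u\<close> (with \<open>q i j\<close> the \<open>i\<close>-derivative of \<open>p j\<close>), and \<open>\<tau>\<close> is the time derivative. This
makes sums, multiples and explicit functions easy to treat.\<close>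

definition C21_on ::
  "((real ^ 'n) \<times> real) set \<Rightarrow> ((real ^ 'n) \<times> real \<Rightarrow> real) \<Rightarrow> ('n \<Rightarrow> (real ^ 'n) \<times> real \<Rightarrow> real) \<Rightarrow>
   ('n \<Rightarrow> 'n \<Rightarrow> (real ^ 'n) \<times> real \<Rightarrow> real) \<Rightarrow> ((real ^ 'n) \<times> real \<Rightarrow> real) \<Rightarrow> bool" where
  "C21_on \<Omega> u p q \<tau> \<longleftrightarrow>
     continuous_on \<Omega> u \<and> (\<forall>j. continuous_on \<Omega> (p j)) \<and> (\<forall>i j. continuous_on \<Omega> (q i j)) \<and>
     (\<forall>z\<in>\<Omega>.
       (\<forall>j. ((\<lambda>h. u (fst z + h *\<^sub>R axis j 1, snd z)) has_real_derivative p j z) (at 0)) \<and>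
       (\<forall>i j. ((\<lambda>h. p j (fst z + h *\<^sub>R axis i 1, snd z)) has_real_derivative q i j z) (at 0)) \<and>
       ((\<lambda>t. u (fst z, t)) has_real_derivative \<tau> z) (at (snd z)))"

lemma C21_on_subset: "C21_on S u p q \<tau> \<Longrightarrow> T \<subseteq> S \<Longrightarrow> C21_on T u p q \<tau>"
  unfolding C21_on_def by (blast intro: continuous_on_subset)

lemma C21_on_add_scaled:
  assumes "C21_on \<Omega> u p q \<tau>" "C21_on \<Omega> v p' q' \<tau>'"
  shows "C21_on \<Omega> (\<lambda>z. u z + k * v z) (\<lambda>j z. p j z + k * p' j z)
    (\<lambda>i j z. q i j z + k * q' i j z) (\<lambda>z. \<tau> z + k * \<tau>' z)"
  using assms unfolding C21_on_def
  by (safe intro!: continuous_intros DERIV_add DERIV_cmult) blast+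

lemma C21_on_minus:
  assumes "C21_on \<Omega> u p q \<tau>"
  shows "C21_on \<Omega> (\<lambda>z. - u z) (\<lambda>j z. - p j z) (\<lambda>i j z. - q i j z) (\<lambda>z. - \<tau> z)"
  using assms unfolding C21_on_def
  by (safe intro!: continuous_intros DERIV_minus) blast+

section \<open>Necessary conditions at a maximum over the past\<close>

lemma second_derivative_nonpos_at_max:
  fixes g G :: "real \<Rightarrow> real"
  assumes "e > 0"
    and g: "\<And>s. \<bar>s\<bar> < e \<Longrightarrow> (g has_real_derivative G s) (at s)"
    and G: "(G has_real_derivative D) (at 0)"
    and max: "\<And>s. \<bar>s\<bar> < e \<Longrightarrow> g s \<le> g 0"
  shows "G 0 = 0" "D \<le> 0"
proof -
  show G0: "G 0 = 0"
    using DERIV_local_max[OF g[of 0] \<open>e > 0\<close>] max \<open>e > 0\<close> by simp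
  show "D \<le> 0"
  proof (rule ccontr)
    assume "\<not> D \<le> 0"
    then obtain d where d: "d > 0" "\<And>h. 0 < h \<Longrightarrow> h < d \<Longrightarrow> G 0 < G (0 + h)"
      using DERIV_pos_inc_right[OF G] by auto
    define s where "s = min d e / 2"
    have s: "0 < s" "s < d" "s < e" using d(1) \<open>e > 0\<close> by (auto simp: s_def)
    obtain x where x: "0 < x" "x < s" "g s - g 0 = (s - 0) * G x"
      using MVT2[of 0 s g G] s g by auto
    have "G x > 0" using d(2)[of x] x s G0 by simp
    then have "g s - g 0 > 0" using x(3) s by simp
    then show False using max[of s] s by simp
  qed
qed

text \<open>The maximum is taken only over points that are not later than \<open>z\<close>. Space is unrestricted, so
the gradient vanishes and the Hessian is negative semidefinite; in time the
comparison is one-sided and leaves only a sign for the time derivative. This is exactly what is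
available at a maximum on the top of a cylinder.\<close>

lemma parabolic_maximum:
  fixes W :: "(real ^ 'n) \<times> real \<Rightarrow> real"
  assumes "open \<Omega>" and W: "C21_on \<Omega> W P Q T" and z: "z \<in> \<Omega>"
    and "d > 0" and max: "\<And>w. w \<in> \<Omega> \<Longrightarrow> dist w z < d \<Longrightarrow> snd w \<le> snd z \<Longrightarrow> W w \<le> W z"
  shows "P j z = 0"
    and "0 \<le> T z"
    and "(\<Sum>i\<in>UNIV. \<Sum>j\<in>UNIV. Q i j z * (\<xi> i * \<xi> j)) \<le> 0"
proof -
  have contP: "continuous_on \<Omega> (P j)" and contQ: "continuous_on \<Omega> (Q i j)"
    and dP: "w \<in> \<Omega> \<Longrightarrow> ((\<lambda>h. W (fst w + h *\<^sub>R axis j 1, snd w)) has_real_derivative P j w) (at 0)"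
    and dQ: "w \<in> \<Omega> \<Longrightarrow> ((\<lambda>h. P j (fst w + h *\<^sub>R axis i 1, snd w)) has_real_derivative Q i j w) (at 0)"
    for i j w
    using W by (auto simp: C21_on_def)
  define N where "N = \<Omega> \<inter> ball z d"
  have N: "open N" "z \<in> N" using \<open>open \<Omega>\<close> z \<open>d > 0\<close> by (auto simp: N_def)
  have dir: "(\<Sum>j\<in>UNIV. P j z * \<xi> $ j) = 0 \<and> (\<Sum>j\<in>UNIV. (\<Sum>i\<in>UNIV. Q i j z * \<xi> $ i) * \<xi> $ j) \<le> 0"
    for \<xi> :: "real ^ 'n"
  proof -
    define l where "l = (\<lambda>s. (fst z + s *\<^sub>R \<xi>, snd z))"
    have l0: "l 0 = z" by (simp add: l_def)
    have "open (l -` N)"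
      using N(1) unfolding l_def
      by (intro open_vimage continuous_intros) auto
    moreover have "0 \<in> l -` N" using N(2) l0 by simp
    ultimately obtain e where e: "e > 0" "ball 0 e \<subseteq> l -` N"
      by (meson open_contains_ball)
    have lN: "l s \<in> N" if "\<bar>s\<bar> < e" for s
      using that e(2) by auto
    define G where "G = (\<lambda>s. \<Sum>j\<in>UNIV. P j (l s) * \<xi> $ j)"
    have "((\<lambda>s. W (l s)) has_real_derivative G s) (at s)" if "\<bar>s\<bar> < e" for s
    proof -
      have "l s \<in> \<Omega>" using lN[OF that] by (simp add: N_def)
      from directional_derivative[OF \<open>open \<Omega>\<close> this dP contP, of \<xi>]
      have "((\<lambda>h. W (l (h + s))) has_real_derivative G s) (at 0)"
        by (simp add: G_def l_def algebra_simps)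
      then show ?thesis
        using DERIV_shift[of "\<lambda>s. W (l s)" "G s" 0 s] by simp
    qed
    moreover have "(G has_real_derivative (\<Sum>j\<in>UNIV. (\<Sum>i\<in>UNIV. Q i j z * \<xi> $ i) * \<xi> $ j)) (at 0)"
      unfolding G_def l_def
      by (intro DERIV_sum DERIV_cmult_right directional_derivative[OF \<open>open \<Omega>\<close> z dQ contQ])
    moreover have "W (l s) \<le> W (l 0)" if "\<bar>s\<bar> < e" for s
      using lN[OF that] max[of "l s"] by (simp add: N_def l0 dist_commute) (simp add: l_def)
    ultimately have "G 0 = 0" "(\<Sum>j\<in>UNIV. (\<Sum>i\<in>UNIV. Q i j z * \<xi> $ i) * \<xi> $ j) \<le> 0"
      using second_derivative_nonpos_at_max[OF e(1), of "\<lambda>s. W (l s)" G] by blast+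
    then show ?thesis by (simp add: G_def l0)
  qed
  have "(\<Sum>i\<in>UNIV. P i z * axis j 1 $ i) = P j z"
    by (simp add: axis_def if_distrib[of "(*) _"] cong: if_cong)
  then show "P j z = 0" using dir[of "axis j 1"] by simp
  have "(\<Sum>i\<in>UNIV. \<Sum>j\<in>UNIV. Q i j z * (\<xi> i * \<xi> j)) =
      (\<Sum>j\<in>UNIV. (\<Sum>i\<in>UNIV. Q i j z * (\<chi> i. \<xi> i) $ i) * (\<chi> i. \<xi> i) $ j)"
    by (subst sum.swap) (simp add: sum_distrib_right mult.assoc)
  then show "(\<Sum>i\<in>UNIV. \<Sum>j\<in>UNIV. Q i j z * (\<xi> i * \<xi> j)) \<le> 0"
    using dir[of "\<chi> i. \<xi> i"] by simp
  show "0 \<le> T z"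
  proof (rule ccontr)
    assume "\<not> 0 \<le> T z"
    moreover have "((\<lambda>t. W (fst z, t)) has_real_derivative T z) (at (snd z))"
      using W z by (simp add: C21_on_def)
    ultimately obtain d' where d': "d' > 0" "\<And>h. 0 < h \<Longrightarrow> h < d' \<Longrightarrow> W z < W (fst z, snd z - h)"
      using DERIV_neg_dec_left[of "\<lambda>t. W (fst z, t)" "T z" "snd z"] by auto
    obtain e where e: "e > 0" "ball z e \<subseteq> N"
      using N by (meson open_contains_ball)
    define h where "h = min d' e / 2"
    have h: "0 < h" "h < d'" "h < e" using d'(1) e(1) by (auto simp: h_def)
    have "dist z (fst z, snd z - h) = h"
      using h by (cases z) (simp add: dist_Pair_Pair dist_real_def)
    then have "(fst z, snd z - h) \<in> N" using h e(2) by auto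
    then have "W (fst z, snd z - h) \<le> W z"
      using h max[of "(fst z, snd z - h)"] by (simp add: N_def dist_commute)
    with d'(2)[of h] h show False by simp
  qed
qed

lemma quadratic_form_eq_sum:
  fixes A :: "real ^ 'n ^ 'n"
  shows "(A *v y) \<bullet> y = (\<Sum>i\<in>UNIV. \<Sum>j\<in>UNIV. A $ i $ j * (y $ i * y $ j))"
  by (simp add: inner_vec_def matrix_vector_mult_def sum_distrib_left sum_distrib_right algebra_simps)

lemma parabolic_maximum_elliptic:
  fixes W :: "(real ^ 'n) \<times> real \<Rightarrow> real" and A :: "real ^ 'n ^ 'n"
  assumes "open \<Omega>" and "C21_on \<Omega> W P Q T" and "z \<in> \<Omega>"
    and "d > 0" and "\<And>w. w \<in> \<Omega> \<Longrightarrow> dist w z < d \<Longrightarrow> snd w \<le> snd z \<Longrightarrow> W w \<le> W z"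
    and sym: "transpose A = A" and psd: "\<And>\<xi>. 0 \<le> (A *v \<xi>) \<bullet> \<xi>"
  shows "(\<Sum>i\<in>UNIV. \<Sum>j\<in>UNIV. A $ i $ j * Q i j z) \<le> 0"
proof (rule psd_nsd_pairing_nonpos)
  show "A $ i $ j = A $ j $ i" for i j
    using arg_cong[OF sym, of "\<lambda>B. B $ j $ i"] by (simp add: transpose_def)
  show "0 \<le> (\<Sum>i\<in>UNIV. \<Sum>j\<in>UNIV. A $ i $ j * (x i * x j))" for x
    using psd[of "\<chi> i. x i"] by (simp add: quadratic_form_eq_sum)
qed (use parabolic_maximum(3)[OF assms(1-5)] in auto)

section \<open>A barrier on an oblique cylinder\<close>

text \<open>The displacement from the axis of the cylinder, the line through \<open>z0\<close> that moves by \<open>v\<close> per unit of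
time elapsed towards the past.\<close>

definition barrier_offset :: "(real ^ 'n) \<times> real \<Rightarrow> real ^ 'n \<Rightarrow> (real ^ 'n) \<times> real \<Rightarrow> real ^ 'n" where
  "barrier_offset z0 v z = fst z - (fst z0 + (snd z0 - snd z) *\<^sub>R v)"

definition barrier_profile :: "(real ^ 'n) \<times> real \<Rightarrow> real ^ 'n \<Rightarrow> real \<Rightarrow> (real ^ 'n) \<times> real \<Rightarrow> real" where
  "barrier_profile z0 v r z = r\<^sup>2 - barrier_offset z0 v z \<bullet> barrier_offset z0 v z"

text \<open>The square makes the barrier degenerate on the lateral boundary, where its second derivatives are
then carried by the gradient of the profile alone; the exponential factor pays for the
errors in the interior.\<close>

definition barrier :: "(real ^ 'n) \<times> real \<Rightarrow> real ^ 'n \<Rightarrow> real \<Rightarrow> real \<Rightarrow> (real ^ 'n) \<times> real \<Rightarrow> real" where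
  "barrier z0 v r K z = exp (- K * snd z) * (barrier_profile z0 v r z)\<^sup>2"

definition barrier_dx :: "(real ^ 'n) \<times> real \<Rightarrow> real ^ 'n \<Rightarrow> real \<Rightarrow> real \<Rightarrow> 'n \<Rightarrow> (real ^ 'n) \<times> real \<Rightarrow> real" where
  "barrier_dx z0 v r K j z =
     exp (- K * snd z) * (- 4 * barrier_profile z0 v r z * barrier_offset z0 v z $ j)"

definition barrier_dxx ::
  "(real ^ 'n) \<times> real \<Rightarrow> real ^ 'n \<Rightarrow> real \<Rightarrow> real \<Rightarrow> 'n \<Rightarrow> 'n \<Rightarrow> (real ^ 'n) \<times> real \<Rightarrow> real" where
  "barrier_dxx z0 v r K i j z = exp (- K * snd z) *
     (8 * (barrier_offset z0 v z $ i * barrier_offset z0 v z $ j)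
       - 4 * barrier_profile z0 v r z * (if i = j then 1 else 0))"

definition barrier_dt :: "(real ^ 'n) \<times> real \<Rightarrow> real ^ 'n \<Rightarrow> real \<Rightarrow> real \<Rightarrow> (real ^ 'n) \<times> real \<Rightarrow> real" where
  "barrier_dt z0 v r K z = exp (- K * snd z) *
     (- K * (barrier_profile z0 v r z)\<^sup>2 - 4 * barrier_profile z0 v r z * (barrier_offset z0 v z \<bullet> v))"

lemma continuous_on_barrier_offset: "continuous_on S (barrier_offset z0 v)"
  unfolding barrier_offset_def by (intro continuous_intros)

lemma continuous_on_barrier_profile: "continuous_on S (barrier_profile z0 v r)"
  unfolding barrier_profile_def by (intro continuous_intros continuous_on_barrier_offset)

lemma C21_on_barrier:
  "C21_on UNIV (barrier z0 v r K) (barrier_dx z0 v r K) (barrier_dxx z0 v r K) (barrier_dt z0 v r K)"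
proof -
  note cont = continuous_on_barrier_offset continuous_on_barrier_profile
  have "((\<lambda>h. barrier z0 v r K (fst z + h *\<^sub>R axis j 1, snd z)) has_real_derivative barrier_dx z0 v r K j z) (at 0)"
    for j z
  proof -
    define y where "y = barrier_offset z0 v z"
    have off: "barrier_offset z0 v (fst z + h *\<^sub>R axis j 1, snd z) = y + h *\<^sub>R axis j 1" for h
      by (simp add: barrier_offset_def y_def)
    have prof: "barrier_profile z0 v r (fst z + h *\<^sub>R axis j 1, snd z) = r\<^sup>2 - (y \<bullet> y + 2 * h * y $ j + h\<^sup>2)" for h
      unfolding barrier_profile_def off
      by (simp add: inner_add_left inner_add_right inner_axis inner_axis' power2_eq_square algebra_simps)
    show ?thesis
      unfolding barrier_def prof snd_conv barrier_dx_def
      unfolding barrier_profile_def y_def[symmetric]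
      by (rule derivative_eq_intros refl)+ (simp add: algebra_simps)
  qed
  moreover have "((\<lambda>h. barrier_dx z0 v r K j (fst z + h *\<^sub>R axis i 1, snd z)) has_real_derivative barrier_dxx z0 v r K i j z) (at 0)"
    for i j z
  proof -
    define y where "y = barrier_offset z0 v z"
    have off: "barrier_offset z0 v (fst z + h *\<^sub>R axis i 1, snd z) = y + h *\<^sub>R axis i 1" for h
      by (simp add: barrier_offset_def y_def)
    have comp: "(y + h *\<^sub>R axis i 1) $ j = y $ j + h * (if i = j then 1 else 0)" for h
      by (simp add: axis_def)
    have prof: "barrier_profile z0 v r (fst z + h *\<^sub>R axis i 1, snd z) = r\<^sup>2 - (y \<bullet> y + 2 * h * y $ i + h\<^sup>2)" for h
      unfolding barrier_profile_def off
      by (simp add: inner_add_left inner_add_right inner_axis inner_axis' power2_eq_square algebra_simps)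
    show ?thesis
      unfolding barrier_dx_def prof off comp snd_conv barrier_dxx_def
      unfolding barrier_profile_def y_def[symmetric]
      by (rule derivative_eq_intros refl)+ (simp add: algebra_simps)
  qed
  moreover have "((\<lambda>t. barrier z0 v r K (fst z, t)) has_real_derivative barrier_dt z0 v r K z) (at (snd z))" for z
  proof -
    define y where "y = barrier_offset z0 v z"
    have off: "barrier_offset z0 v (fst z, t) = y + (t - snd z) *\<^sub>R v" for t
      by (simp add: barrier_offset_def y_def algebra_simps)
    have prof: "barrier_profile z0 v r (fst z, t) =
        r\<^sup>2 - (y \<bullet> y + 2 * (t - snd z) * (y \<bullet> v) + (t - snd z)\<^sup>2 * (v \<bullet> v))" for t
      unfolding barrier_profile_def off
      by (simp add: inner_add_left inner_add_right power2_eq_square inner_commute algebra_simps)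
    show ?thesis
      unfolding barrier_def prof snd_conv barrier_dt_def
      unfolding barrier_profile_def y_def[symmetric]
      by (rule derivative_eq_intros refl)+ (simp add: algebra_simps power2_eq_square)
  qed
  moreover have "continuous_on UNIV (barrier z0 v r K)" "continuous_on UNIV (barrier_dx z0 v r K j)"
     "continuous_on UNIV (barrier_dxx z0 v r K i j)" for i j
    unfolding barrier_def barrier_dx_def barrier_dxx_def
    by (intro continuous_intros cont)+
  ultimately show ?thesis unfolding C21_on_def by blast
qed

text \<open>The expression is a quadratic polynomial in \<open>x\<close> with positive constant term, so a
large leading coefficient makes its discriminant negative.\<close>

lemma quadratic_positive:
  fixes m D :: real
  assumes "m > 0"
  shows "\<exists>\<kappa>. \<forall>x. 8 * m - D * x + \<kappa> * x\<^sup>2 > 0"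
proof (intro exI allI)
  fix x
  \<comment> \<open>Any leading coefficient above \<open>D\<^sup>2 / (32 * m)\<close> works; here it is twice that value.\<close>
  have "8 * m - D * x + D\<^sup>2 / (16 * m) * x\<^sup>2 = ((D * x - 8 * m)\<^sup>2 + 64 * m\<^sup>2) / (16 * m)"
    using assms by (simp add: field_simps power2_eq_square)
  also have "\<dots> > 0"
    using assms by (intro divide_pos_pos add_nonneg_pos) auto
  finally show "8 * m - D * x + D\<^sup>2 / (16 * m) * x\<^sup>2 > 0" .
qed

text \<open>Put \<open>y\<close> for the offset and \<open>\<phi> = r\<^sup>2 - |y|\<^sup>2\<close> for the profile. Up to the exponential factor the
operator applied to the barrier is
\<open>8 (A y \<bullet> y) - 4 \<phi> (tr A + \<beta> \<bullet> y - y \<bullet> v) + (K - k) \<phi>\<^sup>2\<close>.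
By ellipticity this is at least \<open>8 l r\<^sup>2 - (8 l + C) \<phi> + (K - k) \<phi>\<^sup>2\<close>, a quadratic polynomial
in \<open>\<phi>\<close> with positive constant term, so a large \<open>K\<close> makes it positive on the whole cylinder at once:
the constant term prevails near the lateral boundary, and the last term inside.\<close>

lemma barrier_strict_subsolution:
  fixes A :: "(real ^ 'n) \<times> real \<Rightarrow> real ^ 'n ^ 'n" and \<beta> :: "(real ^ 'n) \<times> real \<Rightarrow> real ^ 'n"
  assumes "l > 0" "r > 0"
    and ell: "\<And>z \<xi>. l * (norm \<xi>)\<^sup>2 \<le> (A z *v \<xi>) \<bullet> \<xi>"
    and diag: "\<And>z i. A z $ i $ i \<le> L"
    and \<beta>: "\<And>z. norm (\<beta> z) \<le> B"
  shows "\<exists>K. \<forall>z. norm (barrier_offset z0 v z) \<le> r \<longrightarrow>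
    (\<Sum>i\<in>UNIV. \<Sum>j\<in>UNIV. A z $ i $ j * barrier_dxx z0 v r K i j z)
    + (\<Sum>j\<in>UNIV. \<beta> z $ j * barrier_dx z0 v r K j z)
    - k * barrier z0 v r K z - barrier_dt z0 v r K z > 0"
proof -
  define C where "C = 4 * (real CARD('n) * L + B * r + r * norm v)"
  obtain \<kappa> where \<kappa>: "8 * (l * r\<^sup>2) - (8 * l + C) * x + \<kappa> * x\<^sup>2 > 0" for x
    using quadratic_positive[of "l * r\<^sup>2" "8 * l + C"] \<open>l > 0\<close> \<open>r > 0\<close> by auto
  show ?thesis
  proof (intro exI[of _ "\<kappa> + k"] allI impI)
    fix z
    define y where "y = barrier_offset z0 v z"
    define \<phi> where "\<phi> = barrier_profile z0 v r z"
    define E where "E = exp (- (\<kappa> + k) * snd z)"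
    define tr where "tr = (\<Sum>i\<in>UNIV. A z $ i $ i)"
    assume "norm (barrier_offset z0 v z) \<le> r"
    then have y: "norm y \<le> r" by (simp add: y_def)
    have \<phi>: "\<phi> = r\<^sup>2 - (norm y)\<^sup>2"
      by (simp add: \<phi>_def y_def barrier_profile_def power2_norm_eq_inner)
    then have \<phi>0: "\<phi> \<ge> 0" using power_mono[OF y norm_ge_zero, of 2] by simp
    have "E > 0" by (simp add: E_def)
    have "(\<Sum>i\<in>UNIV. \<Sum>j\<in>UNIV. A z $ i $ j * barrier_dxx z0 v r (\<kappa> + k) i j z) =
       (\<Sum>i\<in>UNIV. \<Sum>j\<in>UNIV. E * 8 * (A z $ i $ j * (y $ i * y $ j))) -
       (\<Sum>i\<in>UNIV. \<Sum>j\<in>UNIV. E * 4 * \<phi> * (if i = j then A z $ i $ j else 0))"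
      unfolding barrier_dxx_def y_def[symmetric] \<phi>_def[symmetric] E_def[symmetric] sum_subtractf[symmetric]
      by (intro sum.cong refl) (auto simp: algebra_simps)
    also have "\<dots> = E * (8 * ((A z *v y) \<bullet> y) - 4 * \<phi> * tr)"
      unfolding sum_distrib_left[symmetric] quadratic_form_eq_sum[symmetric]
      by (simp add: tr_def algebra_simps)
    finally have 1: "(\<Sum>i\<in>UNIV. \<Sum>j\<in>UNIV. A z $ i $ j * barrier_dxx z0 v r (\<kappa> + k) i j z) =
      E * (8 * ((A z *v y) \<bullet> y) - 4 * \<phi> * tr)" .
    have 2: "(\<Sum>j\<in>UNIV. \<beta> z $ j * barrier_dx z0 v r (\<kappa> + k) j z) = E * (- 4 * \<phi> * (\<beta> z \<bullet> y))"
      unfolding barrier_dx_def y_def[symmetric] \<phi>_def[symmetric] E_def[symmetric]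
      by (simp add: inner_vec_def sum_distrib_left algebra_simps sum_negf)
    have 3: "barrier z0 v r (\<kappa> + k) z = E * \<phi>\<^sup>2"
      by (simp add: barrier_def E_def \<phi>_def)
    have 4: "barrier_dt z0 v r (\<kappa> + k) z = E * (- (\<kappa> + k) * \<phi>\<^sup>2 - 4 * \<phi> * (y \<bullet> v))"
      by (simp only: barrier_dt_def E_def \<phi>_def y_def)
    have "tr \<le> real CARD('n) * L"
      unfolding tr_def using sum_bounded_above[of UNIV "\<lambda>i. A z $ i $ i" L] diag by simp
    moreover have "\<beta> z \<bullet> y \<le> B * r"
      using norm_cauchy_schwarz[of "\<beta> z" y] mult_mono[OF \<beta>[of z] y] \<beta>[of z] norm_ge_zero[of "\<beta> z"]
      by (meson norm_ge_zero order_trans)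
    moreover have "- (y \<bullet> v) \<le> r * norm v"
      using norm_cauchy_schwarz[of "- y" v] mult_right_mono[OF y norm_ge_zero[of v]] by simp
    ultimately have "4 * (tr + \<beta> z \<bullet> y - y \<bullet> v) \<le> C"
      unfolding C_def by simp
    then have "\<phi> * (4 * (tr + \<beta> z \<bullet> y - y \<bullet> v)) \<le> \<phi> * C"
      using \<phi>0 by (rule mult_left_mono)
    moreover have "8 * ((A z *v y) \<bullet> y) \<ge> 8 * (l * r\<^sup>2) - 8 * l * \<phi>"
      using ell[of y z] by (simp add: \<phi> algebra_simps)
    ultimately have "8 * ((A z *v y) \<bullet> y) - 4 * \<phi> * tr - 4 * \<phi> * (\<beta> z \<bullet> y) + \<kappa> * \<phi>\<^sup>2 + 4 * \<phi> * (y \<bullet> v) > 0"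
      using \<kappa>[of \<phi>] by (simp add: algebra_simps)
    then have "E * (8 * ((A z *v y) \<bullet> y) - 4 * \<phi> * tr - 4 * \<phi> * (\<beta> z \<bullet> y) + \<kappa> * \<phi>\<^sup>2 + 4 * \<phi> * (y \<bullet> v)) > 0"
      using \<open>E > 0\<close> by simp
    then show "(\<Sum>i\<in>UNIV. \<Sum>j\<in>UNIV. A z $ i $ j * barrier_dxx z0 v r (\<kappa> + k) i j z)
      + (\<Sum>j\<in>UNIV. \<beta> z $ j * barrier_dx z0 v r (\<kappa> + k) j z)
      - k * barrier z0 v r (\<kappa> + k) z - barrier_dt z0 v r (\<kappa> + k) z > 0"
      unfolding 1 2 3 4 by (simp add: algebra_simps)
  qed
qed

section \<open>Propagation of zeros along segments directed to the past\<close>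

text \<open>Suppose \<open>u z1 < 0\<close>. Then \<open>u\<close> is bounded away from zero on a small disc around \<open>z1\<close> at the time of
\<open>z1\<close>, and the thin oblique cylinder over this disc, with the segment as its axis, stays in \<open>\<Omega>\<close>. A
small multiple of the barrier can be added to \<open>u\<close> so that the sum is still nonpositive on the bottom
and on the lateral boundary. The sum is a strict subsolution, so it cannot have a positive maximum
elsewhere, the top included. Hence it is nonpositive at \<open>z0\<close>, where the barrier is positive, and
\<open>u z0 < 0\<close> follows.\<close>

lemma zero_propagates_along_segment:
  fixes A :: "(real ^ 'n) \<times> real \<Rightarrow> real ^ 'n ^ 'n" and \<beta> :: "(real ^ 'n) \<times> real \<Rightarrow> real ^ 'n"
  assumes "open \<Omega>" and u: "C21_on \<Omega> u p q \<tau>"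
    and nonpos: "\<And>z. z \<in> \<Omega> \<Longrightarrow> u z \<le> 0"
    and sub: "\<And>z. z \<in> \<Omega> \<Longrightarrow>
      0 \<le> (\<Sum>i\<in>UNIV. \<Sum>j\<in>UNIV. A z $ i $ j * q i j z) + (\<Sum>j\<in>UNIV. \<beta> z $ j * p j z) - k * u z - \<tau> z"
    and "k \<ge> 0" "l > 0"
    and sym: "\<And>z. transpose (A z) = A z"
    and ell: "\<And>z \<xi>. l * (norm \<xi>)\<^sup>2 \<le> (A z *v \<xi>) \<bullet> \<xi>"
    and diag: "\<And>z i. A z $ i $ i \<le> L"
    and \<beta>: "\<And>z. norm (\<beta> z) \<le> B"
    and seg: "closed_segment z0 z1 \<subseteq> \<Omega>" and time: "snd z1 < snd z0"
    and zero: "u z0 = 0"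
  shows "u z1 = 0"
proof (rule ccontr)
  assume "u z1 \<noteq> 0"
  have z1: "z1 \<in> \<Omega>" using seg by auto
  have neg: "u z1 < 0" using nonpos[OF z1] \<open>u z1 \<noteq> 0\<close> by simp
  have contu: "continuous_on \<Omega> u" using u by (simp add: C21_on_def)
  obtain e where e: "e > 0" "(\<Union>x\<in>closed_segment z0 z1. ball x e) \<subseteq> \<Omega>"
    using compact_subset_open_imp_ball_epsilon_subset[OF compact_segment \<open>open \<Omega>\<close> seg] .
  define \<eta> where "\<eta> = - u z1 / 2"
  have "\<eta> > 0" using neg by (simp add: \<eta>_def)
  obtain d where d: "d > 0" "\<And>w. w \<in> \<Omega> \<Longrightarrow> dist w z1 < d \<Longrightarrow> u w < - \<eta>"
  proof -
    obtain d where d: "d > 0" "\<And>w. w \<in> \<Omega> \<Longrightarrow> dist w z1 < d \<Longrightarrow> dist (u w) (u z1) < \<eta>"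
      using contu z1 \<open>\<eta> > 0\<close> unfolding continuous_on_iff by blast
    show thesis
    proof (rule that[OF d(1)])
      show "u w < - \<eta>" if "w \<in> \<Omega>" "dist w z1 < d" for w
        using d(2)[OF that] by (simp add: dist_real_def \<eta>_def abs_less_iff)
    qed
  qed
  define r where "r = min e d / 2"
  have r: "r > 0" "r < e" "r < d" using e(1) d(1) by (auto simp: r_def)
  define D where "D = snd z0 - snd z1"
  have "D > 0" using time by (simp add: D_def)
  \<comment> \<open>With this velocity the axis of the cylinder is the segment from \<open>z0\<close> to \<open>z1\<close>.\<close>
  define v where "v = (1 / D) *\<^sub>R (fst z1 - fst z0)"
  define y where "y = barrier_offset z0 v"
  have Dv: "D *\<^sub>R v = fst z1 - fst z0" using \<open>D > 0\<close> by (simp add: v_def)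
  have y0: "y z0 = 0" by (simp add: y_def barrier_offset_def)
  have y1: "y z1 = 0" using Dv by (simp add: y_def barrier_offset_def D_def[symmetric])
  define Q where "Q = {z. snd z1 \<le> snd z \<and> snd z \<le> snd z0 \<and> norm (y z) \<le> r}"
  have "Q = (\<lambda>(w, t). (fst z0 + (snd z0 - t) *\<^sub>R v + w, t)) ` (cball 0 r \<times> {snd z1..snd z0})"
  proof (intro equalityI subsetI)
    fix z assume "z \<in> Q"
    then show "z \<in> (\<lambda>(w, t). (fst z0 + (snd z0 - t) *\<^sub>R v + w, t)) ` (cball 0 r \<times> {snd z1..snd z0})"
      by (intro image_eqI[of _ _ "(y z, snd z)"]) (auto simp: Q_def y_def barrier_offset_def)
  qed (auto simp: Q_def y_def barrier_offset_def)
  moreover have "compact \<dots>"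
    unfolding case_prod_unfold
    by (intro compact_continuous_image compact_Times compact_cball compact_Icc continuous_intros)
  ultimately have "compact Q" by simp
  have Q\<Omega>: "Q \<subseteq> \<Omega>"
  proof
    fix z assume z: "z \<in> Q"
    define w where "w = (fst z0 + (snd z0 - snd z) *\<^sub>R v, snd z)"
    define s where "s = (snd z0 - snd z) / D"
    have s: "0 \<le> s" "s \<le> 1" "s * D = snd z0 - snd z"
      using z \<open>D > 0\<close> by (auto simp: s_def Q_def D_def)
    have "w = (1 - s) *\<^sub>R z0 + s *\<^sub>R z1"
    proof (rule prod_eqI)
      have "fst w = fst z0 + s *\<^sub>R (D *\<^sub>R v)" by (simp add: w_def s(3))
      then show "fst w = fst ((1 - s) *\<^sub>R z0 + s *\<^sub>R z1)"
        unfolding Dv by (simp add: algebra_simps)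
      show "snd w = snd ((1 - s) *\<^sub>R z0 + s *\<^sub>R z1)"
        using s(3) by (simp add: w_def D_def algebra_simps)
    qed
    then have "w \<in> closed_segment z0 z1" using s by (auto simp: in_segment)
    moreover have "dist w z = norm (y z)"
      by (cases z) (simp add: dist_Pair_Pair w_def y_def barrier_offset_def dist_norm norm_minus_commute)
    then have "z \<in> ball w e" using z r by (simp add: Q_def)
    ultimately show "z \<in> \<Omega>" using e(2) by blast
  qed
  have z0Q: "z0 \<in> Q" using time y0 r by (simp add: Q_def)
  obtain K where K: "\<And>z. norm (barrier_offset z0 v z) \<le> r \<Longrightarrow>
    (\<Sum>i\<in>UNIV. \<Sum>j\<in>UNIV. A z $ i $ j * barrier_dxx z0 v r K i j z)
    + (\<Sum>j\<in>UNIV. \<beta> z $ j * barrier_dx z0 v r K j z)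
    - k * barrier z0 v r K z - barrier_dt z0 v r K z > 0"
    using barrier_strict_subsolution[where A = A and \<beta> = \<beta>, OF \<open>l > 0\<close> r(1) ell diag \<beta>] by blast
  \<comment> \<open>On the bottom the barrier is at most the denominator, and there \<open>u < - \<eta>\<close>.\<close>
  define \<epsilon> where "\<epsilon> = \<eta> / (exp (- K * snd z1) * (r\<^sup>2)\<^sup>2)"
  have "\<epsilon> > 0" using \<open>\<eta> > 0\<close> r by (simp add: \<epsilon>_def)
  define W where "W = (\<lambda>z. u z + \<epsilon> * barrier z0 v r K z)"
  define P where "P = (\<lambda>j z. p j z + \<epsilon> * barrier_dx z0 v r K j z)"
  define V where "V = (\<lambda>i j z. q i j z + \<epsilon> * barrier_dxx z0 v r K i j z)"
  define T where "T = (\<lambda>z. \<tau> z + \<epsilon> * barrier_dt z0 v r K z)"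
  have W: "C21_on \<Omega> W P V T"
    unfolding W_def P_def V_def T_def
    by (intro C21_on_add_scaled u C21_on_subset[OF C21_on_barrier]) simp
  then have "continuous_on Q W"
    using Q\<Omega> continuous_on_subset by (auto simp: C21_on_def)
  then have "\<exists>z\<in>Q. \<forall>w\<in>Q. W w \<le> W z"
    using z0Q by (intro continuous_attains_sup \<open>compact Q\<close>) auto
  then obtain z where z: "z \<in> Q" "\<And>w. w \<in> Q \<Longrightarrow> W w \<le> W z"
    by blast
  have "W z \<le> 0"
  proof (rule ccontr)
    assume "\<not> W z \<le> 0"
    then have Wpos: "W z > 0" by simp
    have z\<Omega>: "z \<in> \<Omega>" using z Q\<Omega> by blast
    have profile: "barrier_profile z0 v r z = r\<^sup>2 - (norm (y z))\<^sup>2"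
      by (simp add: barrier_profile_def y_def power2_norm_eq_inner)
    have "norm (y z) \<noteq> r"
    proof
      assume "norm (y z) = r"
      then have "W z = u z" by (simp add: W_def barrier_def profile)
      then show False using Wpos nonpos[OF z\<Omega>] by simp
    qed
    then have yr: "norm (y z) < r" using z(1) by (simp add: Q_def)
    have "snd z \<noteq> snd z1"
    proof
      assume bottom: "snd z = snd z1"
      have "fst z - fst z1 = y z - y z1"
        using bottom by (simp add: y_def barrier_offset_def)
      then have "dist z z1 = norm (y z)"
        using bottom y1 by (cases z; cases z1) (simp add: dist_Pair_Pair dist_norm)
      then have "u z < - \<eta>" using d(2)[OF z\<Omega>] yr r by simp
      moreover have "(barrier_profile z0 v r z)\<^sup>2 \<le> (r\<^sup>2)\<^sup>2"
        unfolding profile using yr r power_mono[of "norm (y z)" r 2]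
        by (intro power_mono) auto
      then have "\<epsilon> * barrier z0 v r K z \<le> \<epsilon> * (exp (- K * snd z1) * (r\<^sup>2)\<^sup>2)"
        unfolding barrier_def bottom using \<open>\<epsilon> > 0\<close> by (intro mult_left_mono) auto
      moreover have "\<epsilon> * (exp (- K * snd z1) * (r\<^sup>2)\<^sup>2) = \<eta>"
        using r by (simp add: \<epsilon>_def)
      ultimately show False using Wpos by (simp add: W_def)
    qed
    then have tz: "snd z1 < snd z" "snd z \<le> snd z0" using z(1) by (auto simp: Q_def)
    have "open {w. norm (y w) < r \<and> snd z1 < snd w}"
      unfolding y_def
      by (intro open_Collect_conj open_Collect_less continuous_intros continuous_on_barrier_offset)
    then obtain d' where d': "d' > 0" "ball z d' \<subseteq> {w. norm (y w) < r \<and> snd z1 < snd w}"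
      using yr tz unfolding open_contains_ball by blast
    have max: "W w \<le> W z" if "w \<in> \<Omega>" "dist w z < d'" "snd w \<le> snd z" for w
    proof -
      have "w \<in> ball z d'" using that(2) by (simp add: dist_commute)
      then have "w \<in> Q" using d'(2) that(3) tz by (force simp: Q_def)
      then show ?thesis by (rule z(2))
    qed
    have psd: "0 \<le> (A z *v \<xi>) \<bullet> \<xi>" for \<xi>
      using ell[of \<xi> z] \<open>l > 0\<close> by (meson mult_nonneg_nonneg less_imp_le order_trans zero_le_power2)
    note m = \<open>open \<Omega>\<close> W z\<Omega> d'(1) max
    have P0: "P j z = 0" for j using parabolic_maximum(1)[OF m] .
    have T0: "0 \<le> T z" using parabolic_maximum(2)[OF m] .
    have Q0: "(\<Sum>i\<in>UNIV. \<Sum>j\<in>UNIV. A z $ i $ j * V i j z) \<le> 0"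
      using parabolic_maximum_elliptic[OF m sym psd] .
    have "0 < (\<Sum>i\<in>UNIV. \<Sum>j\<in>UNIV. A z $ i $ j * V i j z) + (\<Sum>j\<in>UNIV. \<beta> z $ j * P j z)
        - k * W z - T z"
    proof -
      have "(\<Sum>i\<in>UNIV. \<Sum>j\<in>UNIV. A z $ i $ j * V i j z) =
         (\<Sum>i\<in>UNIV. \<Sum>j\<in>UNIV. A z $ i $ j * q i j z) +
         \<epsilon> * (\<Sum>i\<in>UNIV. \<Sum>j\<in>UNIV. A z $ i $ j * barrier_dxx z0 v r K i j z)"
        by (simp add: V_def sum.distrib sum_distrib_left algebra_simps)
      moreover have "(\<Sum>j\<in>UNIV. \<beta> z $ j * P j z) = (\<Sum>j\<in>UNIV. \<beta> z $ j * p j z) +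
         \<epsilon> * (\<Sum>j\<in>UNIV. \<beta> z $ j * barrier_dx z0 v r K j z)"
        by (simp add: P_def sum.distrib sum_distrib_left algebra_simps)
      moreover have "0 < \<epsilon> * ((\<Sum>i\<in>UNIV. \<Sum>j\<in>UNIV. A z $ i $ j * barrier_dxx z0 v r K i j z)
         + (\<Sum>j\<in>UNIV. \<beta> z $ j * barrier_dx z0 v r K j z)
         - k * barrier z0 v r K z - barrier_dt z0 v r K z)"
        using K[of z] yr \<open>\<epsilon> > 0\<close> by (simp add: y_def)
      ultimately show ?thesis
        using sub[OF z\<Omega>] by (simp add: W_def T_def algebra_simps)
    qed
    moreover have "k * W z \<ge> 0" using \<open>k \<ge> 0\<close> Wpos by simp
    ultimately show False using P0 T0 Q0 by simp
  qed
  then have "W z0 \<le> 0" using z(2)[OF z0Q] by simp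
  moreover have "barrier_profile z0 v r z0 = r\<^sup>2"
    using y0 by (simp add: barrier_profile_def y_def)
  ultimately have "\<epsilon> * (exp (- K * snd z0) * (r\<^sup>2)\<^sup>2) \<le> 0"
    using zero by (simp add: W_def barrier_def)
  moreover have "0 < \<epsilon> * (exp (- K * snd z0) * (r\<^sup>2)\<^sup>2)"
    using \<open>\<epsilon> > 0\<close> r(1) by simp
  ultimately show False by linarith
qed

section \<open>Admissible curves\<close>

lemma absolutely_continuous_on_imp_uniform:
  assumes "absolutely_continuous_on a b g" "\<epsilon> > 0"
  shows "\<exists>\<delta>>0. \<forall>s\<in>{a..b}. \<forall>t\<in>{a..b}. dist s t < \<delta> \<longrightarrow> dist (g s) (g t) < \<epsilon>"
proof -
  obtain \<delta> where \<delta>: "\<delta> > 0" "\<And>D. D division_of \<Union>D \<Longrightarrow> \<Union>D \<subseteq> {a..b} \<Longrightarrow> (\<Sum>K\<in>D. Sup K - Inf K) < \<delta> \<Longrightarrow>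
        (\<Sum>K\<in>D. norm (g (Sup K) - g (Inf K))) < \<epsilon>"
    using assms unfolding absolutely_continuous_on_def by meson
  have *: "dist (g s) (g t) < \<epsilon>" if "s \<in> {a..b}" "t \<in> {a..b}" "s \<le> t" "t - s < \<delta>" for s t
  proof -
    have "{{s..t}} division_of {s..t}"
      using division_of_self[of s t] that(3) by simp
    then show ?thesis
      using \<delta>(2)[of "{{s..t}}"] that by (simp add: dist_norm norm_minus_commute)
  qed
  show ?thesis
  proof (intro exI[of _ \<delta>] conjI \<delta>(1) ballI impI)
    fix s t assume "s \<in> {a..b}" "t \<in> {a..b}" "dist s t < \<delta>"
    then show "dist (g s) (g t) < \<epsilon>"
      using *[of s t] *[of t s] by (cases "s \<le> t") (auto simp: dist_real_def dist_commute)
  qed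
qed

lemma absolutely_continuous_on_imp_continuous_on:
  assumes "absolutely_continuous_on a b g"
  shows "continuous_on {a..b} g"
  unfolding continuous_on_iff
  using absolutely_continuous_on_imp_uniform[OF assms] by (metis dist_commute)

lemma absolutely_continuous_on_snd:
  assumes "absolutely_continuous_on a b g"
  shows "absolutely_continuous_on a b (\<lambda>s. snd (g s))"
proof -
  have "(\<Sum>K\<in>D. norm (snd (g (Sup K)) - snd (g (Inf K)))) \<le> (\<Sum>K\<in>D. norm (g (Sup K) - g (Inf K)))" for D
    unfolding snd_diff[symmetric] by (intro sum_mono) (metis norm_snd_le prod.collapse)
  then show ?thesis
    using assms unfolding absolutely_continuous_on_def by (meson le_less_trans)
qed

text \<open>The fundamental theorem of calculus for absolutely continuous functions, in the case of a constant
derivative. With \<open>F s = g s - s *\<^sub>R c\<close>, choose a fine tagged division. Intervals tagged at a point of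
differentiability contribute to the increment of \<open>F\<close> at most \<open>\<epsilon>\<close> times their length. The
others lie in an open set of small measure around the exceptional null set, and
absolute continuity bounds the sum of their increments.\<close>

lemma absolutely_continuous_constant_derivative:
  fixes g :: "real \<Rightarrow> 'a::real_normed_vector"
  assumes ac: "absolutely_continuous_on a b g"
    and ae: "AE s in lebesgue_on {a..b}. (g has_vector_derivative c) (at s within {a..b})"
    and x: "x \<in> {a..b}"
  shows "g x = g a + (x - a) *\<^sub>R c"
proof -
  define F where "F = (\<lambda>s. g s - s *\<^sub>R c)"
  obtain N where N: "N \<in> null_sets lebesgue"
    and deriv: "\<And>s. s \<in> {a..b} - N \<Longrightarrow> (g has_vector_derivative c) (at s within {a..b})"
    using AE_E3[OF ae] by (metis (no_types, lifting) sets_completionI_sets lborelD borel_closed closed_atLeastAtMost null_sets_restrict_space space_lebesgue_on)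
  have bound: "norm (F x - F a) \<le> \<epsilon> * (x - a + 1 + norm c)" if "\<epsilon> > 0" for \<epsilon>
  proof -
    obtain \<delta> where \<delta>: "\<delta> > 0" "\<And>D. D division_of \<Union>D \<Longrightarrow> \<Union>D \<subseteq> {a..b} \<Longrightarrow> (\<Sum>K\<in>D. Sup K - Inf K) < \<delta> \<Longrightarrow>
          (\<Sum>K\<in>D. norm (g (Sup K) - g (Inf K))) < \<epsilon>"
      using ac \<open>\<epsilon> > 0\<close> unfolding absolutely_continuous_on_def by meson
    define \<mu> where "\<mu> = min \<delta> \<epsilon>"
    have "\<mu> > 0" using \<delta>(1) \<open>\<epsilon> > 0\<close> by (simp add: \<mu>_def)
    obtain U where U: "open U" "N \<subseteq> U" "U - N \<in> lmeasurable" "emeasure lebesgue (U - N) < ennreal \<mu>"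
      using sets_lebesgue_outer_open[of N \<mu>] N \<open>\<mu> > 0\<close> by auto
    have "emeasure lebesgue U < ennreal \<mu>"
      using U N emeasure_Diff_null_set[of N lebesgue U] by simp
    moreover have Um: "U \<in> lmeasurable"
      using U(1) calculation by (auto simp: fmeasurable_def intro: less_trans)
    ultimately have Uless: "measure lebesgue U < \<mu>"
      by (metis emeasure_eq_measure2 ennreal_less_iff measure_nonneg)
    have "\<exists>\<rho>>0. \<forall>y\<in>{a..b}. \<bar>y - s\<bar> < \<rho> \<longrightarrow> norm (F y - F s) \<le> \<epsilon> * \<bar>y - s\<bar>" if "s \<in> {a..b} - N" for s
      using deriv[OF that] \<open>\<epsilon> > 0\<close>
      unfolding has_vector_derivative_def has_derivative_within_alt F_def
      by (simp add: algebra_simps)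
    then obtain \<rho> where \<rho>: "\<And>s. s \<in> {a..b} - N \<Longrightarrow> \<rho> s > 0"
      "\<And>s y. s \<in> {a..b} - N \<Longrightarrow> y \<in> {a..b} \<Longrightarrow> \<bar>y - s\<bar> < \<rho> s \<Longrightarrow> norm (F y - F s) \<le> \<epsilon> * \<bar>y - s\<bar>"
      by metis
    \<comment> \<open>A tag in \<open>N\<close> forces its interval into \<open>U\<close>, any other tag into the range of the derivative estimate.\<close>
    define d where "d = (\<lambda>s. if s \<in> N then U else if s \<in> {a..b} then ball s (\<rho> s) else UNIV)"
    have "gauge d"
      unfolding gauge_def d_def using U \<rho>(1) by auto
    then obtain p where p: "p tagged_division_of {a..x}" "d fine p"
      by (rule fine_division_exists_real)
    have finp: "finite p" using p(1) by auto
    have ivl: "\<exists>u v. K = {u..v} \<and> u \<le> s \<and> s \<le> v \<and> a \<le> u \<and> v \<le> x" if sK: "(s, K) \<in> p" for s K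
    proof -
      obtain u v where "K = {u..v}" using tagged_division_ofD(4)[OF p(1) sK] by auto
      then show ?thesis
        using tagged_division_ofD(2,3)[OF p(1) sK] by fastforce
    qed
    define Bad where "Bad = {(s, K). (s, K) \<in> p \<and> s \<in> N}"
    define Good where "Good = p - Bad"
    have "Bad \<subseteq> p" by (auto simp: Bad_def)
    have total: "(\<Sum>(s, K)\<in>p. F (Sup K) - F (Inf K)) = F x - F a"
      "(\<Sum>(s, K)\<in>p. Sup K - Inf K) = x - a"
      using additive_tagged_division_1[OF _ p(1), of F] additive_tagged_division_1[OF _ p(1), of "\<lambda>x. x"] assms(3)
      by auto
    have good: "(\<Sum>(s, K)\<in>Good. norm (F (Sup K) - F (Inf K))) \<le> \<epsilon> * (x - a)"
    proof -
      have "(\<Sum>(s, K)\<in>Good. norm (F (Sup K) - F (Inf K))) \<le> (\<Sum>(s, K)\<in>Good. \<epsilon> * (Sup K - Inf K))"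
      proof (intro sum_mono, clarify)
        fix s K assume sK: "(s, K) \<in> Good"
        then have sp: "(s, K) \<in> p" and sN: "s \<notin> N" by (auto simp: Good_def Bad_def)
        obtain u v where K: "K = {u..v}" "u \<le> s" "s \<le> v" "a \<le> u" "v \<le> x" using ivl[OF sp] by blast
        have sab: "s \<in> {a..b} - N" using K sN x by auto
        have "K \<subseteq> ball s (\<rho> s)"
          using p(2) sp sab unfolding fine_def d_def by fastforce
        moreover have "u \<in> K" "v \<in> K" using K by auto
        ultimately have "u \<in> ball s (\<rho> s)" "v \<in> ball s (\<rho> s)" by blast+
        then have "\<bar>u - s\<bar> < \<rho> s" "\<bar>v - s\<bar> < \<rho> s"
          by (auto simp: dist_real_def)
        then have "norm (F u - F s) \<le> \<epsilon> * \<bar>u - s\<bar>" "norm (F v - F s) \<le> \<epsilon> * \<bar>v - s\<bar>"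
          using \<rho>(2)[OF sab, of u] \<rho>(2)[OF sab, of v] K x by auto
        then have "norm (F v - F u) \<le> \<epsilon> * (v - u)"
          using norm_triangle_ineq4[of "F v - F s" "F u - F s"] K by (simp add: algebra_simps)
        then show "norm (F (Sup K) - F (Inf K)) \<le> \<epsilon> * (Sup K - Inf K)" using K by simp
      qed
      also have "\<dots> \<le> (\<Sum>(s, K)\<in>p. \<epsilon> * (Sup K - Inf K))"
      proof (rule sum_mono2[OF finp])
        show "0 \<le> (case sK of (s, K) \<Rightarrow> \<epsilon> * (Sup K - Inf K))" if "sK \<in> p - Good" for sK
          using ivl[of "fst sK" "snd sK"] that \<open>\<epsilon> > 0\<close> by (cases sK) auto
      qed (auto simp: Good_def)
      also have "\<dots> = \<epsilon> * (\<Sum>(s, K)\<in>p. Sup K - Inf K)"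
        by (simp add: sum_distrib_left case_prod_unfold)
      finally show ?thesis by (simp add: total)
    qed
    have bad: "(\<Sum>(s, K)\<in>Bad. norm (F (Sup K) - F (Inf K))) \<le> \<epsilon> * (1 + norm c)"
    proof -
      define D where "D = snd ` Bad"
      have "Bad tagged_partial_division_of {a..x}"
        using tagged_partial_division_subset[of p "{a..x}" Bad] p(1) \<open>Bad \<subseteq> p\<close>
        by (simp add: tagged_division_of_def)
      then have tag: "Bad tagged_division_of \<Union>D"
        unfolding D_def by (rule tagged_partial_division_of_Union_self)
      then have div: "D division_of \<Union>D"
        unfolding D_def by (rule division_of_tagged_division)
      have DK: "\<exists>u v. K = {u..v} \<and> u \<le> v \<and> a \<le> u \<and> v \<le> x" if "K \<in> D" for K
        using that ivl \<open>Bad \<subseteq> p\<close> unfolding D_def by fastforce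
      have "\<Union>D \<subseteq> U"
      proof
        fix y assume "y \<in> \<Union>D"
        then obtain s K where "(s, K) \<in> p" "s \<in> N" "y \<in> K" by (auto simp: D_def Bad_def)
        then show "y \<in> U" using p(2) unfolding fine_def d_def by fastforce
      qed
      have "(\<Sum>K\<in>D. Sup K - Inf K) = (\<Sum>K\<in>D. measure lebesgue K)"
        using DK by (intro sum.cong refl) fastforce
      also have "\<dots> = measure lebesgue (\<Union>D)"
        using content_division[OF div] by simp
      also have "\<dots> \<le> measure lebesgue U"
        using \<open>\<Union>D \<subseteq> U\<close> Um lmeasurable_division[OF div] by (intro measure_mono_fmeasurable) auto
      finally have small: "(\<Sum>K\<in>D. Sup K - Inf K) < \<mu>" using Uless by simp
      have "\<Union>D \<subseteq> {a..b}" using DK x by fastforce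
      then have g: "(\<Sum>K\<in>D. norm (g (Sup K) - g (Inf K))) < \<epsilon>"
        using \<delta>(2)[OF div] small by (simp add: \<mu>_def)
      \<comment> \<open>Distinct tagged intervals coincide as sets only if they are degenerate, so that the sum over
          \<open>Bad\<close> becomes a sum over \<open>D\<close>. The value of \<open>H\<close> at the empty set is a default, as \<open>Sup {}\<close> is unspecified.\<close>
      define H where "H = (\<lambda>K. if K = {} then 0 else norm (F (Sup K) - F (Inf K)))"
      have "(\<Sum>(s, K)\<in>Bad. norm (F (Sup K) - F (Inf K))) = (\<Sum>(s, K)\<in>Bad. H K)"
        by (intro sum.cong refl) (auto simp: H_def dest: tagged_division_ofD(2)[OF tag])
      also have "\<dots> = (\<Sum>K\<in>D. H K)"
        unfolding D_def
      proof (rule sum.over_tagged_division_lemma[OF tag])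
        show "H (cbox u v) = 0" if "box u v = {}" for u v :: real
          using that by (cases "u = v") (auto simp: H_def box_eq_empty)
      qed
      also have "\<dots> = (\<Sum>K\<in>D. norm (F (Sup K) - F (Inf K)))"
        using division_ofD(3)[OF div] by (intro sum.cong refl) (auto simp: H_def)
      also have "\<dots> \<le> (\<Sum>K\<in>D. norm (g (Sup K) - g (Inf K)) + (Sup K - Inf K) * norm c)"
      proof (rule sum_mono)
        fix K assume "K \<in> D"
        then obtain u v where K: "K = {u..v}" "u \<le> v" using DK by blast
        have "F v - F u = (g v - g u) - (v - u) *\<^sub>R c" by (simp add: F_def algebra_simps)
        then show "norm (F (Sup K) - F (Inf K)) \<le> norm (g (Sup K) - g (Inf K)) + (Sup K - Inf K) * norm c"
          using norm_triangle_ineq4[of "g v - g u" "(v - u) *\<^sub>R c"] K by simp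
      qed
      also have "\<dots> = (\<Sum>K\<in>D. norm (g (Sup K) - g (Inf K))) + (\<Sum>K\<in>D. Sup K - Inf K) * norm c"
        by (simp add: sum.distrib sum_distrib_right)
      also have "\<dots> \<le> \<epsilon> + \<epsilon> * norm c"
        using g small by (intro add_mono mult_right_mono) (auto simp: \<mu>_def)
      finally show ?thesis by (simp add: algebra_simps)
    qed
    have "norm (F x - F a) \<le> (\<Sum>(s, K)\<in>p. norm (F (Sup K) - F (Inf K)))"
      unfolding total(1)[symmetric] case_prod_unfold by (rule norm_sum)
    also have "\<dots> = (\<Sum>(s, K)\<in>Good. norm (F (Sup K) - F (Inf K))) + (\<Sum>(s, K)\<in>Bad. norm (F (Sup K) - F (Inf K)))"
      unfolding Good_def by (rule sum.subset_diff[OF \<open>Bad \<subseteq> p\<close> finp])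
    also have "\<dots> \<le> \<epsilon> * (x - a) + \<epsilon> * (1 + norm c)"
      using good bad by (rule add_mono)
    finally show ?thesis by (simp add: algebra_simps)
  qed
  have pos: "x - a + 1 + norm c > 0" using x by (simp add: add_pos_nonneg)
  have "norm (F x - F a) \<le> 0"
  proof (rule field_le_epsilon)
    fix e :: real assume "e > 0"
    then show "norm (F x - F a) \<le> 0 + e"
      using bound[of "e / (x - a + 1 + norm c)"] pos by simp
  qed
  then show ?thesis by (simp add: F_def algebra_simps)
qed

lemma admissible_curve_continuous_on: "admissible_curve T \<gamma> \<Longrightarrow> continuous_on {0..T} \<gamma>"
  unfolding admissible_curve_def by (blast intro: absolutely_continuous_on_imp_continuous_on)

text \<open>This makes every segment between two successive points of an admissible curve point to the past.\<close>

lemma admissible_curve_time: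
  assumes "admissible_curve T \<gamma>" "s \<in> {0..T}"
  shows "snd (\<gamma> s) = snd (\<gamma> 0) - s"
proof -
  obtain x' where ac: "absolutely_continuous_on 0 T \<gamma>"
    and ae: "AE s in lebesgue_on {0..T}. (\<gamma> has_vector_derivative (x' s, -1)) (at s within {0..T})"
    using assms(1) unfolding admissible_curve_def by blast
  have "AE s in lebesgue_on {0..T}. ((\<lambda>s. snd (\<gamma> s)) has_vector_derivative -1) (at s within {0..T})"
    using ae by eventually_elim (drule bounded_linear.has_vector_derivative[OF bounded_linear_snd], simp)
  from absolutely_continuous_constant_derivative[OF absolutely_continuous_on_snd[OF ac] this assms(2)]
  show ?thesis by simp
qed

text \<open>By uniform continuity consecutive points of a fine subdivision are closer than the distance of the
curve from the complement of \<open>\<Omega>\<close>, so the segments joining them stay in \<open>\<Omega>\<close>. They are directed to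
the past, and the zero travels along the resulting polygon, which has the same end point as the curve.\<close>

lemma zero_propagates_along_curve:
  fixes u :: "(real ^ 'n) \<times> real \<Rightarrow> real"
  assumes "open \<Omega>" and \<gamma>: "admissible_curve T \<gamma>" "\<gamma> ` {0..T} \<subseteq> \<Omega>" and "T \<ge> 0"
    and seg: "\<And>a b. closed_segment a b \<subseteq> \<Omega> \<Longrightarrow> snd b < snd a \<Longrightarrow> u a = 0 \<Longrightarrow> u b = 0"
    and zero: "u (\<gamma> 0) = 0"
  shows "u (\<gamma> T) = 0"
proof (cases "T = 0")
  case True
  then show ?thesis using zero by simp
next
  case False
  then have "T > 0" using \<open>T \<ge> 0\<close> by simp
  have cont: "continuous_on {0..T} \<gamma>" using admissible_curve_continuous_on[OF \<gamma>(1)] .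
  obtain e where e: "e > 0" "(\<Union>x\<in>\<gamma> ` {0..T}. ball x e) \<subseteq> \<Omega>"
    using compact_subset_open_imp_ball_epsilon_subset[OF compact_continuous_image[OF cont compact_Icc] \<open>open \<Omega>\<close> \<gamma>(2)] .
  have "uniformly_continuous_on {0..T} \<gamma>"
    by (rule compact_uniformly_continuous[OF cont compact_Icc])
  then obtain \<delta> where \<delta>: "\<delta> > 0" "\<And>s t. s \<in> {0..T} \<Longrightarrow> t \<in> {0..T} \<Longrightarrow> dist t s < \<delta> \<Longrightarrow> dist (\<gamma> t) (\<gamma> s) < e"
    unfolding uniformly_continuous_on_def using e(1) by meson
  obtain n :: nat where "T / \<delta> < real n" using reals_Archimedean2 by blast
  moreover have "0 < T / \<delta>" using \<open>T > 0\<close> \<delta>(1) by simp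
  ultimately have n: "real n > 0" by linarith
  then have step: "T / real n < \<delta>"
    using \<open>T / \<delta> < real n\<close> \<delta>(1) by (simp add: field_simps)
  have "u (\<gamma> (real k * (T / n))) = 0" if "k \<le> n" for k
    using that
  proof (induction k)
    case 0
    then show ?case using zero by simp
  next
    case (Suc k)
    define s where "s = real k * (T / n)"
    define t where "t = real (Suc k) * (T / n)"
    have st: "t = s + T / n" by (simp add: s_def t_def algebra_simps add_divide_distrib)
    have "t \<le> real n * (T / n)"
      unfolding t_def using Suc.prems \<open>T > 0\<close> by (intro mult_right_mono) auto
    then have tT: "t \<le> T" using n by simp
    have "s \<ge> 0" using \<open>T > 0\<close> by (simp add: s_def)
    have lt: "s < t" using st \<open>T > 0\<close> n by simp
    then have sm: "s \<in> {0..T}" and tm: "t \<in> {0..T}"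
      using tT \<open>s \<ge> 0\<close> by auto
    have "dist (\<gamma> t) (\<gamma> s) < e" using \<delta>(2)[OF sm tm] st n step \<open>T > 0\<close> by (simp add: dist_real_def)
    then have "closed_segment (\<gamma> s) (\<gamma> t) \<subseteq> ball (\<gamma> s) e"
      using e(1) by (intro closed_segment_subset) (auto simp: dist_commute)
    also have "\<dots> \<subseteq> \<Omega>" using e(2) sm by blast
    finally have "closed_segment (\<gamma> s) (\<gamma> t) \<subseteq> \<Omega>" .
    moreover have "snd (\<gamma> t) < snd (\<gamma> s)"
      using admissible_curve_time[OF \<gamma>(1) sm] admissible_curve_time[OF \<gamma>(1) tm] lt by simp
    moreover have "u (\<gamma> s) = 0" using Suc by (simp add: s_def)
    ultimately show ?case unfolding t_def[symmetric] by (rule seg)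
  qed
  from this[of n] show ?thesis using n by simp
qed

section \<open>From the divergence form to the nondivergence form\<close>

lemma has_derivative_dx:
  "x_differentiable i g z \<Longrightarrow>
    ((\<lambda>h. g (fst z + h *\<^sub>R axis i 1, snd z)) has_real_derivative dx i g z) (at 0)"
  by (simp add: x_differentiable_def dx_def DERIV_deriv_iff_field_differentiable)

lemma C21_on_classical_solution:
  assumes "classical_solution A b c f \<Omega> u"
  shows "C21_on \<Omega> u (\<lambda>j. dx j u) (\<lambda>i j. dx i (dx j u)) (dt u)"
  using assms unfolding classical_solution_def C21_on_def
  by (auto intro: has_derivative_dx simp: t_differentiable_def dt_def DERIV_deriv_iff_field_differentiable)

text \<open>The first-order coefficient of the operator once the divergence is carried out.\<close>

definition drift :: "((real ^ 'n) \<times> real \<Rightarrow> real ^ 'n ^ 'n) \<Rightarrow> ((real ^ 'n) \<times> real \<Rightarrow> real ^ 'n) \<Rightarrow>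
   (real ^ 'n) \<times> real \<Rightarrow> real ^ 'n" where
  "drift A b z = (\<chi> j. (\<Sum>i\<in>UNIV. dx i (\<lambda>w. A w $ i $ j) z) + b z $ j)"

lemma parabolic_op_nondivergence:
  assumes A: "\<And>i j. x_differentiable i (\<lambda>w. A w $ i $ j) z"
    and u: "\<And>i j. x_differentiable i (dx j u) z"
  shows "parabolic_op A b c u z =
    (\<Sum>i\<in>UNIV. \<Sum>j\<in>UNIV. A z $ i $ j * dx i (dx j u) z)
    + (\<Sum>j\<in>UNIV. drift A b z $ j * dx j u z) + c z * u z - dt u z"
proof -
  have "dx i (\<lambda>w. (A w *v grad_x u w) $ i) z =
    (\<Sum>j\<in>UNIV. dx i (\<lambda>w. A w $ i $ j) z * dx j u z + A z $ i $ j * dx i (dx j u) z)" for i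
  proof -
    have "((\<lambda>h. \<Sum>j\<in>UNIV. A (fst z + h *\<^sub>R axis i 1, snd z) $ i $ j * dx j u (fst z + h *\<^sub>R axis i 1, snd z))
      has_real_derivative
      (\<Sum>j\<in>UNIV. dx i (\<lambda>w. A w $ i $ j) z * dx j u z + dx i (dx j u) z * A z $ i $ j)) (at 0)"
      using DERIV_mult[OF has_derivative_dx[OF A] has_derivative_dx[OF u]]
      by (intro DERIV_sum) simp
    then show ?thesis
      unfolding dx_def[of i "\<lambda>w. (A w *v grad_x u w) $ i"]
      by (intro DERIV_imp_deriv) (simp add: matrix_vector_mult_def grad_x_def mult.commute)
  qed
  moreover have "b z \<bullet> grad_x u z = (\<Sum>j\<in>UNIV. b z $ j * dx j u z)"
    by (simp add: inner_vec_def grad_x_def)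
  moreover have "(\<Sum>i\<in>UNIV. \<Sum>j\<in>UNIV. dx i (\<lambda>w. A w $ i $ j) z * dx j u z) =
     (\<Sum>j\<in>UNIV. (\<Sum>i\<in>UNIV. dx i (\<lambda>w. A w $ i $ j) z) * dx j u z)"
    by (subst sum.swap) (simp add: sum_distrib_right)
  ultimately show ?thesis
    by (simp add: parabolic_op_def div_x_def drift_def sum.distrib algebra_simps)
qed

lemma norm_drift_le:
  fixes A :: "(real ^ 'n) \<times> real \<Rightarrow> real ^ 'n ^ 'n"
  assumes "\<And>i j. \<bar>dx i (\<lambda>w. A w $ i $ j) z\<bar> \<le> L" and "\<And>i. \<bar>b z $ i\<bar> \<le> L"
  shows "norm (drift A b z) \<le> real CARD('n) * (real CARD('n) * L + L)"
proof -
  have "\<bar>drift A b z $ j\<bar> \<le> real CARD('n) * L + L" for j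
  proof -
    have "\<bar>\<Sum>i\<in>UNIV. dx i (\<lambda>w. A w $ i $ j) z\<bar> \<le> real CARD('n) * L"
      using order_trans[OF sum_abs sum_bounded_above[of UNIV "\<lambda>i. \<bar>dx i (\<lambda>w. A w $ i $ j) z\<bar>" L]] assms(1)
      by simp
    then show ?thesis
      using assms(2)[of j] by (simp add: drift_def)
  qed
  then have "(\<Sum>j\<in>UNIV. \<bar>drift A b z $ j\<bar>) \<le> real CARD('n) * (real CARD('n) * L + L)"
    using sum_bounded_above[of UNIV "\<lambda>j. \<bar>drift A b z $ j\<bar>"] by simp
  then show ?thesis using norm_le_l1_cart order_trans by blast
qed

section \<open>The strong maximum principle\<close>

text \<open>The zeros of \<open>u\<close> contain the attainable set by propagation along curves, \<open>f\<close> vanishes wherever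
\<open>u\<close> does, and the common zero set is closed in \<open>\<Omega>\<close>.\<close>

lemma strong_maximum_principle:
  fixes A :: "(real ^ 'n) \<times> real \<Rightarrow> real ^ 'n ^ 'n" and \<beta> :: "(real ^ 'n) \<times> real \<Rightarrow> real ^ 'n"
  assumes "open \<Omega>" and u: "C21_on \<Omega> u p q \<tau>" and contf: "continuous_on \<Omega> f"
    and eq: "\<And>z. z \<in> \<Omega> \<Longrightarrow>
      (\<Sum>i\<in>UNIV. \<Sum>j\<in>UNIV. A z $ i $ j * q i j z) + (\<Sum>j\<in>UNIV. \<beta> z $ j * p j z) + c z * u z - \<tau> z = f z"
    and nonpos: "\<And>z. z \<in> \<Omega> \<Longrightarrow> u z \<le> 0" and f: "\<And>z. z \<in> \<Omega> \<Longrightarrow> f z \<ge> 0"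
    and "l > 0"
    and sym: "\<And>z. transpose (A z) = A z"
    and ell: "\<And>z \<xi>. l * (norm \<xi>)\<^sup>2 \<le> (A z *v \<xi>) \<bullet> \<xi>"
    and diag: "\<And>z i. A z $ i $ i \<le> L"
    and \<beta>: "\<And>z. norm (\<beta> z) \<le> B"
    and c: "\<And>z. \<bar>c z\<bar> \<le> L"
    and z0: "z0 \<in> \<Omega>" "u z0 = 0"
    and z: "z \<in> top_of_set \<Omega> closure_of attainable_set \<Omega> z0"
  shows "u z = 0 \<and> f z = 0"
proof -
  have L: "L \<ge> 0" using c[of z0] by simp
  \<comment> \<open>As \<open>u \<le> 0\<close>, replacing \<open>c\<close> by its lower bound \<open>- L\<close> can only increase the left-hand side.\<close>
  have seg: "u z2 = 0" if "closed_segment z1 z2 \<subseteq> \<Omega>" "snd z2 < snd z1" "u z1 = 0" for z1 z2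
  proof (rule zero_propagates_along_segment[OF \<open>open \<Omega>\<close> u nonpos _ L \<open>l > 0\<close> sym ell diag \<beta> that])
    fix w assume w: "w \<in> \<Omega>"
    have "(c w + L) * u w \<le> 0"
      using nonpos[OF w] c[of w] by (intro mult_nonneg_nonpos) (auto simp: abs_le_iff)
    then show "0 \<le> (\<Sum>i\<in>UNIV. \<Sum>j\<in>UNIV. A w $ i $ j * q i j w) + (\<Sum>j\<in>UNIV. \<beta> w $ j * p j w) - L * u w - \<tau> w"
      using eq[OF w] f[OF w] by (simp add: algebra_simps)
  qed auto
  \<comment> \<open>At a zero, which is a maximum of \<open>u\<close>, each term of the operator is nonpositive, while \<open>f \<ge> 0\<close>.\<close>
  have f0: "f w = 0" if w: "w \<in> \<Omega>" "u w = 0" for w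
  proof -
    have max: "u w' \<le> u w" if "w' \<in> \<Omega>" "dist w' w < 1" "snd w' \<le> snd w" for w'
      using nonpos[OF that(1)] w by simp
    have psd: "0 \<le> (A w *v \<xi>) \<bullet> \<xi>" for \<xi>
      using ell[of \<xi> w] \<open>l > 0\<close> by (meson mult_nonneg_nonneg less_imp_le order_trans zero_le_power2)
    note m = \<open>open \<Omega>\<close> u w(1) zero_less_one max
    have "f w \<le> 0"
      using parabolic_maximum(1,2)[OF m] parabolic_maximum_elliptic[OF m sym psd] eq[OF w(1)] w(2)
      by simp
    then show ?thesis using f[OF w(1)] by simp
  qed
  have "attainable_set \<Omega> z0 \<subseteq> {w \<in> \<Omega>. u w = 0} \<inter> {w \<in> \<Omega>. f w = 0}"
  proof
    fix w assume "w \<in> attainable_set \<Omega> z0"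
    then obtain T \<gamma> where *: "w \<in> \<Omega>" "T \<ge> 0" "admissible_curve T \<gamma>" "\<gamma> ` {0..T} \<subseteq> \<Omega>" "\<gamma> 0 = z0" "\<gamma> T = w"
      by (auto simp: attainable_set_def)
    then have "u w = 0"
      using zero_propagates_along_curve[OF \<open>open \<Omega>\<close> *(3,4,2) seg] z0 by simp
    then show "w \<in> {w \<in> \<Omega>. u w = 0} \<inter> {w \<in> \<Omega>. f w = 0}" using f0 *(1) by simp
  qed
  moreover have "closedin (top_of_set \<Omega>) ({w \<in> \<Omega>. u w = 0} \<inter> {w \<in> \<Omega>. f w = 0})"
    using u contf by (intro closedin_Int continuous_closedin_preimage_constant) (auto simp: C21_on_def)
  ultimately show ?thesis
    using closure_of_minimal z by blast
qed

theorem proposition1p4: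
  fixes A :: "(real ^ 'n) \<times> real \<Rightarrow> real ^ 'n ^ 'n"
    and b :: "(real ^ 'n) \<times> real \<Rightarrow> real ^ 'n"
    and c f u :: "(real ^ 'n) \<times> real \<Rightarrow> real"
    and M \<alpha> l L :: real
    and \<Omega> :: "((real ^ 'n) \<times> real) set"
    and z0 :: "(real ^ 'n) \<times> real"
  assumes symmetric: "\<And>z. transpose (A z) = A z"
    and constants: "M > 0" "0 < \<alpha>" "\<alpha> \<le> 1" "0 < l" "l < L"
    and A_diff: "\<And>i j z. x_differentiable i (\<lambda>w. A w $ i $ j) z"
    and b_diff: "\<And>i z. x_differentiable i (\<lambda>w. b w $ i) z"
    and hoelder:
      "parabolic_hoelder M \<alpha> c"
      "\<And>i j. parabolic_hoelder M \<alpha> (\<lambda>w. A w $ i $ j)"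
      "\<And>i j. parabolic_hoelder M \<alpha> (dx i (\<lambda>w. A w $ i $ j))"
      "\<And>i. parabolic_hoelder M \<alpha> (\<lambda>w. b w $ i)"
      "\<And>i. parabolic_hoelder M \<alpha> (dx i (\<lambda>w. b w $ i))"
    and bounded_coefficients: "bounded (range A)" "bounded (range b)" "bounded (range c)"
    and elliptic:
      "\<And>z \<xi>. l * (norm \<xi>)\<^sup>2 \<le> (A z *v \<xi>) \<bullet> \<xi>"
      "\<And>z \<xi>. (A z *v \<xi>) \<bullet> \<xi> \<le> L * (norm \<xi>)\<^sup>2"
    and bounds:
      "\<And>i j z. \<bar>dx i (\<lambda>w. A w $ i $ j) z\<bar> \<le> L"
      "\<And>i z. \<bar>b z $ i\<bar> \<le> L"
      "\<And>z. \<bar>c z\<bar> \<le> L"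
    and "open \<Omega>"
    and "continuous_on \<Omega> f"
    and "classical_solution A b c f \<Omega> u"
    and sign: "(\<forall>z\<in>\<Omega>. u z \<le> 0 \<and> f z \<ge> 0) \<or> (\<forall>z\<in>\<Omega>. u z \<ge> 0 \<and> f z \<le> 0)"
    and "z0 \<in> \<Omega>" and "u z0 = 0"
  shows "\<forall>z \<in> top_of_set \<Omega> closure_of attainable_set \<Omega> z0. u z = 0 \<and> f z = 0"
proof
  fix z assume z: "z \<in> top_of_set \<Omega> closure_of attainable_set \<Omega> z0"
  have cs: "classical_solution A b c f \<Omega> u" by fact
  note C21 = C21_on_classical_solution[OF cs]
  have eq: "(\<Sum>i\<in>UNIV. \<Sum>j\<in>UNIV. A w $ i $ j * dx i (dx j u) w) + (\<Sum>j\<in>UNIV. drift A b w $ j * dx j u w)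
      + c w * u w - dt u w = f w" if "w \<in> \<Omega>" for w
    using parabolic_op_nondivergence[of A w u b c, OF A_diff] cs that
    by (simp add: classical_solution_def)
  have diag: "A w $ i $ i \<le> L" for w i
    using elliptic(2)[of w "axis i 1"] by (simp add: matrix_vector_mul_component inner_axis inner_axis' row_def)
  have drift: "norm (drift A b w) \<le> real CARD('n) * (real CARD('n) * L + L)" for w
    by (intro norm_drift_le bounds)
  show "u z = 0 \<and> f z = 0"
    using sign
  proof
    assume "\<forall>w\<in>\<Omega>. u w \<le> 0 \<and> f w \<ge> 0"
    then show ?thesis
      using \<open>open \<Omega>\<close> \<open>continuous_on \<Omega> f\<close> \<open>z0 \<in> \<Omega>\<close> \<open>u z0 = 0\<close>
      by (intro strong_maximum_principle[OF _ C21 _ eq _ _ constants(4) symmetric elliptic(1) diag drift bounds(3) _ _ z]) auto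
  next
    assume "\<forall>w\<in>\<Omega>. u w \<ge> 0 \<and> f w \<le> 0"
    moreover have "(\<Sum>i\<in>UNIV. \<Sum>j\<in>UNIV. A w $ i $ j * - dx i (dx j u) w) +
        (\<Sum>j\<in>UNIV. drift A b w $ j * - dx j u w) + c w * - u w - - dt u w = - f w" if "w \<in> \<Omega>" for w
      using eq[OF that] by (simp add: sum_negf)
    ultimately have "- u z = 0 \<and> - f z = 0"
      using \<open>open \<Omega>\<close> \<open>continuous_on \<Omega> f\<close> \<open>z0 \<in> \<Omega>\<close> \<open>u z0 = 0\<close>
      by (intro strong_maximum_principle[where f = "\<lambda>w. - f w", OF _ C21_on_minus[OF C21] _ _ _ _ constants(4) symmetric elliptic(1) diag drift bounds(3) _ _ z])
        (auto intro: continuous_on_minus)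
    then show ?thesis by simp
  qed
qed

end
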